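(* Consider the factor model with missing factor described in the context, and the estimator $$\widehat{\bar\sigma}_{nT}^2=\frac{\sum_{t=1}^T\sum_{i=1}^n\hat u_{it}^2}{n(T-K-1)}$$ of $\bar\sigma_n^2=n^{-1}\sum_{i=1}^n\sigma_i^2$, where $\hat u_{it}$ are the OLS residuals from the regression, for each $i$, of $r_{it}$ on an intercept and $\mathbf f_t$. Suppose Assumptions 1, 3 and 4 of the context are satisfied, with $\alpha_\gamma<1/2$. Then for a fixed $T$, $$\lim_{n\to\infty}E\left(\widehat{\bar\sigma}_{nT}^2\right)=\bar\sigma^2,\qquad \bar\sigma^2=\lim_{n\to\infty}\bar\sigma_n^2 .$$ Furthermore, $$\widehat{\bar\sigma}_{nT}^2-\bar\sigma_n^2=O_p\left(T^{-1/2}n^{-1/2}\right).$$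
   Context: Setting. $K$ is a fixed integer. For $i=1,\dots,n$, $t=1,\dots,T$ ($T>K+1$) the excess returns satisfy $r_{it}=a_i+\boldsymbol\beta_i'\mathbf f_t+u_{it}$, $u_{it}=\gamma_ig_t+v_{it}$, where $\mathbf f_t=(f_{1t},\dots,f_{Kt})'$ are observed factors with true mean $\boldsymbol\mu_0$, $\boldsymbol\beta_i=(\beta_{i1},\dots,\beta_{iK})'$, $a_i$ is a fixed intercept (which may contain pricing errors) and $g_t$ is a scalar missing (latent) factor. $\sigma_i^2=E(u_{it}^2)$; the limit $\bar\sigma^2$ is assumed to exist. OLS residuals: $\hat u_{it}=r_{it}-\hat a_{iT}-\hat{\boldsymbol\beta}_{iT}'\mathbf f_t$ with $(\hat a_{iT},\hat{\boldsymbol\beta}_{iT})$ the OLS estimates. Notation. $\boldsymbol\tau_m$ is the $m$-vector of ones, $\mathbf M_m=\mathbf I_m-m^{-1}\boldsymbol\tau_m\boldsymbol\tau_m'$; $\mathbf F=(\mathbf f_1,\dots,\mathbf f_T)'$; $\bar\beta_k=n^{-1}\sum_i\beta_{ik}$. $C$ denotes a generic positive finite constant. $O_p$ statements are for $n\to\infty$ with $T>T_0$ either fixed or tending to infinity jointly with $n$. Assumption 1 (observed factors). (a) $\mathbf f_t=\boldsymbol\mu+\sum_{\ell\ge0}\boldsymbol\Psi_\ell\boldsymbol\zeta_{t-\ell}$, $\|\boldsymbol\mu\|<C$, $\boldsymbol\zeta_t\sim IID(\mathbf 0,\mathbf I_K)$, $\|\boldsymbol\Psi_\ell\|<C\rho^\ell$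 for some $C>0$, $0<\rho<1$. (b) $\mathbf F$ has full column rank and there is $T_0$ such that for all $T>T_0$, $\hat{\boldsymbol\Sigma}_f=T^{-1}\mathbf F'\mathbf M_T\mathbf F$ is positive definite, $\lambda_{\max}(\hat{\boldsymbol\Sigma}_f^{-1})<C$, and $\hat{\boldsymbol\Sigma}_f\to_p\boldsymbol\Sigma_f=E[(\mathbf f_t-\boldsymbol\mu_0)(\mathbf f_t-\boldsymbol\mu_0)']$, which is positive definite. Assumption 3 (latent factor). (a) $g_t$ is independent of $\mathbf f_{t'}$ for all $t,t'$, serially independent, $E(g_t)=0$, $E(g_t^2)=1$, $\sup_tE(g_t^4)<C$. (b) $\sup_i|\gamma_i|<C$ and $\sum_{i=1}^n|\gamma_i|=O(n^{\alpha_\gamma})$. Assumption 4 (idiosyncratic errors). (a) The $v_{it}$ are independent of all $f_{kt'}$, $g_{t'}$ and of the loadings $\beta_{ik},\gamma_i$; they are serially independent with $E(v_{it})=0$, $E(v_{it}^4)<\infty$, $E(v_{it}v_{jt})=\sigma_{v,ij}$, $\sup_i\sum_{j=1}^n|\sigma_{v,ij}|<\infty$, $\sup_i\sum_{j=1}^nCov(v_{it}^2,v_{jt}^2)<\infty$, and $\lambda_{\min}(\mathbf V_v)>0$ with $\mathbf V_v=(\sigma_{v,ij})$. (b) For $k=1,\dots,K$, $T^{-1/2}n^{-\alpha_k/2}\sum_{t=1}^T\sum_{i=1}^n(\beta_{ik}-\bar\beta_k)v_{it}\to_dN(0,\omega_k^2)$, $\omega_k^2=\operatorname{plim}_{n\to\infty}n^{-\alpha_k}\sum_{i,j=1}^n(\beta_{ik}-\bar\beta_k)(\beta_{jk}-\bar\beta_k)\sigma_{v,ij}$,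 where $\alpha_k\in(0,1]$ is the strength of factor $k$, defined by $\sum_{i=1}^n(\beta_{ik}-\bar\beta_k)^2$ being of exact order $n^{\alpha_k}$. *)

theory Defs
  imports "HOL-Probability.Probability" "HOL-Library.Landau_Symbols"
begin

text \<open>
  Units \<open>i\<close> and periods \<open>t\<close> are numbered from \<open>0\<close>: a sample of \<open>n\<close> units and \<open>T\<close> periods is
  \<open>i < n\<close>, \<open>t < T\<close>. The number \<open>K\<close> of observed factors is \<open>CARD('k)\<close>. Random variables and
  processes are functions whose last argument is the outcome \<open>\<omega>\<close>.
\<close>

subsection \<open>Matrices\<close>

text \<open>
  Matrices are functions on a finite index set, so that the same notion serves the
  \<open>K \<times> K\<close> matrices (index set \<open>UNIV\<close>) and the \<open>n \<times> n\<close> ones (index set \<open>{..<n}\<close>, \<open>n\<close> varying).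
  Only symmetric matrices occur, so real eigenvalues suffice.
\<close>

definition eigenvalues :: "'i set \<Rightarrow> ('i \<Rightarrow> 'i \<Rightarrow> real) \<Rightarrow> real set" where
  "eigenvalues I A =
     {c. \<exists>x. (\<exists>i\<in>I. x i \<noteq> 0) \<and> (\<forall>i\<in>I. (\<Sum>j\<in>I. A i j * x j) = c * x i)}"

definition lambda_max :: "'i set \<Rightarrow> ('i \<Rightarrow> 'i \<Rightarrow> real) \<Rightarrow> real" where
  "lambda_max I A = Max (eigenvalues I A)"

definition lambda_min :: "'i set \<Rightarrow> ('i \<Rightarrow> 'i \<Rightarrow> real) \<Rightarrow> real" where
  "lambda_min I A = Min (eigenvalues I A)"

definition pos_def :: "real ^ 'k ^ 'k \<Rightarrow> bool" where
  "pos_def A \<longleftrightarrow> transpose A = A \<and> (\<forall>x. x \<noteq> 0 \<longrightarrow> 0 < x \<bullet> (A *v x))"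

text \<open>The entries of \<open>I - T\<^sup>-\<^sup>1 \<tau> \<tau>'\<close>, with \<open>\<tau>\<close> the \<open>T\<close>-vector of ones.\<close>

definition centering :: "nat \<Rightarrow> nat \<Rightarrow> nat \<Rightarrow> real" where
  "centering T s t = (if s = t then 1 else 0) - 1 / real T"

text \<open>\<open>T\<^sup>-\<^sup>1 F' M\<^sub>T F\<close>, where the \<open>t\<close>-th row of \<open>F\<close> is \<open>x t\<close>.\<close>

definition sample_cov :: "nat \<Rightarrow> (nat \<Rightarrow> real ^ 'k) \<Rightarrow> real ^ 'k ^ 'k" where
  "sample_cov T x =
     (\<chi> k l. (1 / real T) * (\<Sum>s<T. \<Sum>t<T. x s $ k * centering T s t * x t $ l))"

text \<open>Linear independence of the columns of the matrix with rows \<open>x 0, \<dots>, x (T - 1)\<close>.\<close>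

definition full_column_rank :: "nat \<Rightarrow> (nat \<Rightarrow> real ^ 'k) \<Rightarrow> bool" where
  "full_column_rank T x \<longleftrightarrow> (\<forall>b. (\<forall>t<T. x t \<bullet> b = 0) \<longrightarrow> b = 0)"


subsection \<open>Least squares\<close>

definition ols :: "nat \<Rightarrow> (nat \<Rightarrow> real) \<Rightarrow> (nat \<Rightarrow> real ^ 'k) \<Rightarrow> real \<times> (real ^ 'k)" where
  "ols T y x = arg_min (\<lambda>(a, b). \<Sum>t<T. (y t - a - b \<bullet> x t)\<^sup>2) (\<lambda>_. True)"

definition ols_residual :: "nat \<Rightarrow> (nat \<Rightarrow> real) \<Rightarrow> (nat \<Rightarrow> real ^ 'k) \<Rightarrow> nat \<Rightarrow> real" where
  "ols_residual T y x t = y t - fst (ols T y x) - snd (ols T y x) \<bullet> x t"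

definition sigma2_hat ::
  "(nat \<Rightarrow> nat \<Rightarrow> 'w \<Rightarrow> real) \<Rightarrow> (nat \<Rightarrow> 'w \<Rightarrow> real ^ 'k) \<Rightarrow> nat \<Rightarrow> nat \<Rightarrow> 'w \<Rightarrow> real" where
  "sigma2_hat r f n T \<omega> =
     (\<Sum>t<T. \<Sum>i<n. (ols_residual T (\<lambda>t. r i t \<omega>) (\<lambda>t. f t \<omega>) t)\<^sup>2)
       / (real n * (real T - real CARD('k) - 1))"

definition sample_mean :: "nat \<Rightarrow> (nat \<Rightarrow> real) \<Rightarrow> real" where
  "sample_mean n x = (\<Sum>i<n. x i) / real n"


subsection \<open>Asymptotics\<close>

text \<open>
  The number of periods as a function \<open>S\<close> of the number \<open>n\<close> of units: it exceeds \<open>T0\<close> and is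
  either constant or tends to infinity together with \<open>n\<close>, at an arbitrary relative rate.
\<close>

definition horizon :: "nat \<Rightarrow> (nat \<Rightarrow> nat) \<Rightarrow> bool" where
  "horizon T0 S \<longleftrightarrow> (\<forall>n. T0 < S n) \<and>
     ((\<exists>T. \<forall>n. S n = T) \<or> filterlim S at_top sequentially)"

definition normal_law :: "real \<Rightarrow> real measure" where
  "normal_law s2 =
     (if s2 = 0 then return borel 0 else density lborel (normal_density 0 (sqrt s2)))"

context prob_space
begin

definition conv_in_prob :: "(nat \<Rightarrow> 'a \<Rightarrow> 'c :: metric_space) \<Rightarrow> 'c \<Rightarrow> bool" where
  "conv_in_prob X c \<longleftrightarrow>
     (\<forall>\<epsilon>>0. (\<lambda>n. prob {\<omega> \<in> space M. \<epsilon> < dist (X n \<omega>) c}) \<longlonglongrightarrow> 0)"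

definition bounded_in_prob :: "(nat \<Rightarrow> 'a \<Rightarrow> real) \<Rightarrow> (nat \<Rightarrow> real) \<Rightarrow> bool" where
  "bounded_in_prob X b \<longleftrightarrow>
     (\<forall>\<epsilon>>0. \<exists>B. \<forall>\<^sub>F n in sequentially. prob {\<omega> \<in> space M. B * b n < \<bar>X n \<omega>\<bar>} < \<epsilon>)"

text \<open>For a non-random sequence this is \<open>X \<in> \<Theta>(b)\<close>.\<close>

definition exact_order_in_prob :: "(nat \<Rightarrow> 'a \<Rightarrow> real) \<Rightarrow> (nat \<Rightarrow> real) \<Rightarrow> bool" where
  "exact_order_in_prob X b \<longleftrightarrow>
     (\<forall>\<epsilon>>0. \<exists>c>0. \<exists>C. \<forall>\<^sub>F n in sequentially.
        1 - \<epsilon> < prob {\<omega> \<in> space M. c * b n \<le> X n \<omega> \<and> X n \<omega> \<le> C * b n})"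

text \<open>The library's \<open>indep_var\<close> forces both random elements to have the same value type.\<close>

definition indep_of :: "'b measure \<Rightarrow> ('a \<Rightarrow> 'b) \<Rightarrow> 'c measure \<Rightarrow> ('a \<Rightarrow> 'c) \<Rightarrow> bool" where
  "indep_of A X B Y \<longleftrightarrow> random_variable A X \<and> random_variable B Y \<and>
     indep_set {X -` E \<inter> space M | E. E \<in> sets A} {Y -` E \<inter> space M | E. E \<in> sets B}"

definition covariance :: "('a \<Rightarrow> real) \<Rightarrow> ('a \<Rightarrow> real) \<Rightarrow> real" where
  "covariance X Y = expectation (\<lambda>\<omega>. (X \<omega> - expectation X) * (Y \<omega> - expectation Y))"


subsection \<open>Assumptions on the factor model\<close>

text \<open>Square integrability is entailed by the unit variances, since \<open>expectation\<close> is \<open>0\<close> on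
  non-integrable functions.\<close>

definition iid_standardized :: "(int \<Rightarrow> 'a \<Rightarrow> real ^ 'k) \<Rightarrow> bool" where
  "iid_standardized \<zeta> \<longleftrightarrow>
     indep_vars (\<lambda>_. borel) \<zeta> UNIV \<and>
     (\<forall>s t. distr M borel (\<zeta> s) = distr M borel (\<zeta> t)) \<and>
     (\<forall>t. expectation (\<zeta> t) = 0) \<and>
     (\<forall>t k l. expectation (\<lambda>\<omega>. \<zeta> t \<omega> $ k * \<zeta> t \<omega> $ l) = (if k = l then 1 else 0))"

text \<open>
  The bound on \<open>\<lambda>\<^sub>m\<^sub>a\<^sub>x\<close> is uniform in \<open>T\<close> along almost every realisation of the factors. A bound
  uniform over realisations too would contradict the i.i.d. innovations: these are within any
  \<open>\<epsilon>\<close> of a common value for arbitrarily many consecutive periods with positive probability,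
  and then the sample covariance is arbitrarily small.
\<close>

definition observed_factors :: "(nat \<Rightarrow> 'a \<Rightarrow> real ^ 'k) \<Rightarrow> real ^ 'k \<Rightarrow> nat \<Rightarrow> bool" where
  "observed_factors f \<mu>\<^sub>0 T0 \<longleftrightarrow>
     (\<forall>t. random_variable borel (f t)) \<and>
     (\<forall>t. integrable M (f t) \<and> expectation (f t) = \<mu>\<^sub>0) \<and>
     (\<exists>(\<mu> :: real ^ 'k) (\<Psi> :: nat \<Rightarrow> real ^ 'k ^ 'k) \<zeta> C \<rho>.
        0 < C \<and> 0 < \<rho> \<and> \<rho> < 1 \<and> norm \<mu> < C \<and>
        (\<forall>l. onorm ((*v) (\<Psi> l)) < C * \<rho> ^ l) \<and>
        iid_standardized \<zeta> \<and>
        (\<forall>t. AE \<omega> in M. (\<lambda>l. \<Psi> l *v \<zeta> (int t - int l) \<omega>) sums (f t \<omega> - \<mu>))) \<and>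
     (AE \<omega> in M. \<forall>T>T0.
        full_column_rank T (\<lambda>t. f t \<omega>) \<and> pos_def (sample_cov T (\<lambda>t. f t \<omega>))) \<and>
     (AE \<omega> in M. \<exists>C. \<forall>T>T0.
        lambda_max UNIV (\<lambda>k l. matrix_inv (sample_cov T (\<lambda>t. f t \<omega>)) $ k $ l) < C) \<and>
     (\<exists>\<Sigma>\<^sub>f.
        (\<forall>t k l. \<Sigma>\<^sub>f $ k $ l = expectation (\<lambda>\<omega>. (f t \<omega> - \<mu>\<^sub>0) $ k * (f t \<omega> - \<mu>\<^sub>0) $ l)) \<and>
        pos_def \<Sigma>\<^sub>f \<and>
        conv_in_prob (\<lambda>T \<omega>. sample_cov T (\<lambda>t. f t \<omega>)) \<Sigma>\<^sub>f)"

definition latent_factor ::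
  "(nat \<Rightarrow> 'a \<Rightarrow> real ^ 'k) \<Rightarrow> (nat \<Rightarrow> 'a \<Rightarrow> real) \<Rightarrow> (nat \<Rightarrow> real) \<Rightarrow> real \<Rightarrow> bool" where
  "latent_factor f g \<gamma> \<alpha>\<^sub>\<gamma> \<longleftrightarrow>
     indep_of (\<Pi>\<^sub>M t\<in>UNIV. borel) (\<lambda>\<omega> t. g t \<omega>) (\<Pi>\<^sub>M t\<in>UNIV. borel) (\<lambda>\<omega> t. f t \<omega>) \<and>
     indep_vars (\<lambda>_. borel) g UNIV \<and>
     (\<forall>t. expectation (g t) = 0 \<and> expectation (\<lambda>\<omega>. (g t \<omega>)\<^sup>2) = 1) \<and>
     (\<forall>t. integrable M (\<lambda>\<omega>. g t \<omega> ^ 4)) \<and>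
     (\<exists>C. \<forall>t. expectation (\<lambda>\<omega>. g t \<omega> ^ 4) < C) \<and>
     (\<exists>C. \<forall>i. \<bar>\<gamma> i\<bar> < C) \<and>
     (\<lambda>n. \<Sum>i<n. \<bar>\<gamma> i\<bar>) \<in> O(\<lambda>n. real n powr \<alpha>\<^sub>\<gamma>)"

text \<open>
  The loadings \<open>\<beta>\<close> may be random; the loadings \<open>\<gamma>\<close> on the latent factor are constants, so
  independence of \<open>v\<close> from them is automatic. Serial independence is that of the cross sections
  \<open>(v\<^sub>i\<^sub>t)\<^sub>i\<close> over \<open>t\<close>.
\<close>

definition idiosyncratic_errors ::
  "(nat \<Rightarrow> 'a \<Rightarrow> real ^ 'k) \<Rightarrow> (nat \<Rightarrow> 'a \<Rightarrow> real) \<Rightarrow> (nat \<Rightarrow> 'a \<Rightarrow> real ^ 'k) \<Rightarrow>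
   (nat \<Rightarrow> nat \<Rightarrow> 'a \<Rightarrow> real) \<Rightarrow> (nat \<Rightarrow> nat \<Rightarrow> real) \<Rightarrow> bool" where
  "idiosyncratic_errors f g \<beta> v \<sigma>\<^sub>v \<longleftrightarrow>
     indep_of
       (\<Pi>\<^sub>M t\<in>UNIV. \<Pi>\<^sub>M i\<in>UNIV. borel)
       (\<lambda>\<omega> t i. v i t \<omega>)
       ((\<Pi>\<^sub>M t\<in>UNIV. borel) \<Otimes>\<^sub>M (\<Pi>\<^sub>M t\<in>UNIV. borel) \<Otimes>\<^sub>M (\<Pi>\<^sub>M i\<in>UNIV. borel))
       (\<lambda>\<omega>. (\<lambda>t. f t \<omega>, \<lambda>t. g t \<omega>, \<lambda>i. \<beta> i \<omega>)) \<and>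
     indep_vars (\<lambda>_. \<Pi>\<^sub>M i\<in>UNIV. borel) (\<lambda>t \<omega> i. v i t \<omega>) UNIV \<and>
     (\<forall>i t. expectation (v i t) = 0 \<and> integrable M (\<lambda>\<omega>. v i t \<omega> ^ 4)) \<and>
     (\<forall>i j t. expectation (\<lambda>\<omega>. v i t \<omega> * v j t \<omega>) = \<sigma>\<^sub>v i j) \<and>
     (\<exists>C. \<forall>n. \<forall>i<n. (\<Sum>j<n. \<bar>\<sigma>\<^sub>v i j\<bar>) \<le> C) \<and>
     (\<exists>C. \<forall>t n. \<forall>i<n. (\<Sum>j<n. covariance (\<lambda>\<omega>. (v i t \<omega>)\<^sup>2) (\<lambda>\<omega>. (v j t \<omega>)\<^sup>2)) \<le> C) \<and>
     (\<forall>n>0. 0 < lambda_min {..<n} \<sigma>\<^sub>v)"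

text \<open>The deviation \<open>\<beta>\<^sub>i\<^sub>k - n\<^sup>-\<^sup>1 (\<beta>\<^sub>0\<^sub>k + \<dots>)\<close> from the cross-sectional mean of the first \<open>n\<close> units.\<close>

definition loading_dev :: "(nat \<Rightarrow> 'a \<Rightarrow> real ^ 'k) \<Rightarrow> nat \<Rightarrow> 'k \<Rightarrow> nat \<Rightarrow> 'a \<Rightarrow> real" where
  "loading_dev \<beta> n k i \<omega> = \<beta> i \<omega> $ k - sample_mean n (\<lambda>j. \<beta> j \<omega> $ k)"

definition factor_strength :: "(nat \<Rightarrow> 'a \<Rightarrow> real ^ 'k) \<Rightarrow> 'k \<Rightarrow> real \<Rightarrow> bool" where
  "factor_strength \<beta> k \<alpha> \<longleftrightarrow> 0 < \<alpha> \<and> \<alpha> \<le> 1 \<and>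
     exact_order_in_prob (\<lambda>n \<omega>. \<Sum>i<n. (loading_dev \<beta> n k i \<omega>)\<^sup>2) (\<lambda>n. real n powr \<alpha>)"

definition loading_error_clt ::
  "(nat \<Rightarrow> 'a \<Rightarrow> real ^ 'k) \<Rightarrow> (nat \<Rightarrow> nat \<Rightarrow> 'a \<Rightarrow> real) \<Rightarrow> (nat \<Rightarrow> nat \<Rightarrow> real) \<Rightarrow>
   (nat \<Rightarrow> nat) \<Rightarrow> bool" where
  "loading_error_clt \<beta> v \<sigma>\<^sub>v S \<longleftrightarrow>
     (\<forall>k. \<exists>\<alpha> w2. factor_strength \<beta> k \<alpha> \<and> 0 \<le> w2 \<and>
        conv_in_prob
          (\<lambda>n \<omega>. real n powr (- \<alpha>) *
             (\<Sum>i<n. \<Sum>j<n. loading_dev \<beta> n k i \<omega> * loading_dev \<beta> n k j \<omega> * \<sigma>\<^sub>v i j)) w2 \<and>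
        weak_conv_m
          (\<lambda>n. distr M borel (\<lambda>\<omega>. real (S n) powr (- 1/2) * real n powr (- \<alpha> / 2) *
             (\<Sum>t<S n. \<Sum>i<n. loading_dev \<beta> n k i \<omega> * v i t \<omega>)))
          (normal_law w2))"

end

end

theory Submission
  imports Defs
begin

text \<open>
  Since the fitted part of a return is in the span of the regressors, the residual sum of squares of unit
  \<open>i\<close> is \<open>\<Sum>\<^bsub>s,t\<^esub> P\<^bsub>s t\<^esub> u\<^bsub>i s\<^esub> u\<^bsub>i t\<^esub>\<close>, where \<open>P\<close> is the annihilator of the regressors: a random
  matrix that depends on the observed factors only, hence is independent of the errors, and almost surely
  is an orthogonal projection of trace \<open>N = T - K - 1\<close>. Put
  \<open>W\<^bsub>s t\<^esub> = \<Sum>\<^bsub>i < n\<^esub> (u\<^bsub>i s\<^esub> u\<^bsub>i t\<^esub> - E (u\<^bsub>i s\<^esub> u\<^bsub>i t\<^esub>))\<close>. Then \<open>n N\<close> times the estimation error is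
  \<open>\<Sum>\<^bsub>s,t\<^esub> P\<^bsub>s t\<^esub> W\<^bsub>s t\<^esub>\<close>, which has mean \<open>0\<close>: the estimator is exactly unbiased. By serial independence
  \<open>W\<^bsub>s t\<^esub>\<close> and \<open>W\<^bsub>s' t'\<^esub>\<close> are orthogonal unless \<open>{s, t} = {s', t'}\<close>, and \<open>\<Sum>\<^bsub>s,t\<^esub> P\<^bsub>s t\<^esub>\<^sup>2 = N\<close>, so the
  second moment of the sum is at most \<open>2 N\<close> times the largest \<open>E W\<^bsub>s t\<^esub>\<^sup>2\<close>. The latter is of order
  \<open>(\<Sum>\<^bsub>i < n\<^esub> \<gamma>\<^bsub>i\<^esub>\<^sup>2)\<^sup>2 + n\<close>, which is \<open>O(n)\<close> as \<open>\<alpha>\<^bsub>\<gamma>\<^esub> < 1/2\<close>. Chebyshev's inequality gives the rate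
  \<open>(n N)\<^sup>-\<^sup>1\<^sup>/\<^sup>2\<close>, and \<open>N \<ge> T / (K + 2)\<close>.
\<close>

subsection \<open>Least squares\<close>

text \<open>The Gram operator \<open>A\<close> is self-adjoint, so its range is the orthogonal
  complement of its kernel. Solvability therefore holds for designs of any rank.\<close>

lemma normal_equations_solvable:
  fixes w :: "nat \<Rightarrow> 'e::euclidean_space"
  shows "\<exists>z. \<forall>h. (\<Sum>t<T. (y t - z \<bullet> w t) * (h \<bullet> w t)) = 0"
proof -
  define A where "A z = (\<Sum>t<T. (z \<bullet> w t) *\<^sub>R w t)" for z
  have linA: "linear A"
    unfolding A_def
    by (rule linearI) (simp_all add: inner_add_left scaleR_left_distrib sum.distrib scaleR_sum_right)
  have inner_A: "x \<bullet> A z = (\<Sum>t<T. (z \<bullet> w t) * (x \<bullet> w t))" for x z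
    by (simp add: A_def inner_sum_right)
  have "adjoint A = A"
    by (rule adjoint_unique) (metis (no_types, lifting) inner_A inner_commute mult.commute sum.cong)
  then have "A -` {0} = (range A)\<^sup>\<bottom>"
    using ker_orthogonal_comp_adjoint[OF linA] by simp
  then have range_A: "(A -` {0})\<^sup>\<bottom> = range A"
    using orthogonal_comp_self linear_subspace_image[OF linA subspace_UNIV] by simp
  \<comment> \<open>A kernel vector \<open>x\<close> makes \<open>x \<bullet> A x\<close>, a sum of
    squares, vanish; hence it is orthogonal to every \<open>w t\<close>.\<close>
  have "(\<Sum>t<T. y t *\<^sub>R w t) \<in> (A -` {0})\<^sup>\<bottom>"
  proof (clarsimp simp: orthogonal_comp_def)
    fix x assume "A x = 0"
    then have "(\<Sum>t<T. (x \<bullet> w t)\<^sup>2) = 0"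
      using inner_A[of x x] by (simp add: power2_eq_square)
    then have "\<forall>t<T. x \<bullet> w t = 0"
      by (subst (asm) sum_nonneg_eq_0_iff) auto
    then show "orthogonal x (\<Sum>t<T. y t *\<^sub>R w t)"
      by (simp add: orthogonal_def inner_sum_right)
  qed
  then obtain z where z: "A z = (\<Sum>t<T. y t *\<^sub>R w t)"
    using range_A by (metis rangeE)
  have "(\<Sum>t<T. (y t - z \<bullet> w t) * (h \<bullet> w t)) = 0" for h
  proof -
    have "h \<bullet> A z = (\<Sum>t<T. y t * (h \<bullet> w t))"
      by (simp add: z inner_sum_right)
    then show ?thesis
      by (simp add: inner_A left_diff_distrib sum_subtractf)
  qed
  then show ?thesis by blast
qed

section \<open>Residuals and the annihilator matrix\<close>

text \<open>An arbitrary solution of the normal equations is chosen. In a rank-deficient design only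
  the residuals are determined, by \<open>resid_unique\<close>.\<close>

definition lsq :: "nat \<Rightarrow> (nat \<Rightarrow> 'e::euclidean_space) \<Rightarrow> (nat \<Rightarrow> real) \<Rightarrow> 'e" where
  "lsq T w y = (SOME z. \<forall>h. (\<Sum>t<T. (y t - z \<bullet> w t) * (h \<bullet> w t)) = 0)"

definition resid :: "nat \<Rightarrow> (nat \<Rightarrow> 'e::euclidean_space) \<Rightarrow> (nat \<Rightarrow> real) \<Rightarrow> nat \<Rightarrow> real" where
  "resid T w y t = y t - lsq T w y \<bullet> w t"

text \<open>The matrix of the projection onto the orthogonal complement of the regressors, with the
  residuals of the \<open>s\<close>-th unit vector as row \<open>s\<close>. This form avoids
  inverting the Gram matrix.\<close>

definition annihilator :: "nat \<Rightarrow> (nat \<Rightarrow> 'e::euclidean_space) \<Rightarrow> nat \<Rightarrow> nat \<Rightarrow> real" where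
  "annihilator T w s = resid T w (\<lambda>t. if t = s then 1 else 0)"

lemma resid_orthogonal: "(\<Sum>t<T. resid T w y t * (h \<bullet> w t)) = 0"
  using someI_ex[OF normal_equations_solvable[where T = T and y = y and w = w]]
  unfolding resid_def lsq_def by blast

text \<open>The difference \<open>h\<close> of two solutions is itself an admissible test direction.
  Subtracting the two normal equations in direction \<open>h\<close> leaves the sum of squares of
  its fitted values.\<close>

lemma resid_unique:
  assumes orth: "\<And>h. (\<Sum>t<T. (y t - z \<bullet> w t) * (h \<bullet> w t)) = 0" and "t < T"
  shows "resid T w y t = y t - z \<bullet> w t"
proof -
  define h where "h = z - lsq T w y"
  have "(\<Sum>t<T. (h \<bullet> w t)\<^sup>2)
      = (\<Sum>t<T. resid T w y t * (h \<bullet> w t)) - (\<Sum>t<T. (y t - z \<bullet> w t) * (h \<bullet> w t))"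
    by (simp add: resid_def h_def sum_subtractf[symmetric] inner_diff_left power2_eq_square algebra_simps)
  also have "\<dots> = 0"
    by (simp add: resid_orthogonal orth)
  finally have "\<forall>t<T. h \<bullet> w t = 0"
    by (subst (asm) sum_nonneg_eq_0_iff) auto
  then show ?thesis
    using \<open>t < T\<close> by (simp add: resid_def h_def inner_diff_left)
qed

text \<open>The chosen coefficients \<open>lsq\<close> need not be linear in \<open>y\<close>.
  Superposing the solutions for unit vectors nevertheless solves the normal equations for
  \<open>y\<close>, and residuals are unique.\<close>

lemma resid_eq_annihilator_sum:
  assumes "t < T"
  shows "resid T w y t = (\<Sum>s<T. y s * annihilator T w s t)"
proof -
  define e where "e s t = (if t = s then 1 else 0 :: real)" for s t :: nat
  define z where "z = (\<Sum>s<T. y s *\<^sub>R lsq T w (e s))"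
  have ann: "annihilator T w s t = e s t - lsq T w (e s) \<bullet> w t" for s t
    by (simp add: annihilator_def resid_def e_def[abs_def])
  have *: "y t - z \<bullet> w t = (\<Sum>s<T. y s * annihilator T w s t)" if "t < T" for t
    using that
    by (simp add: ann z_def right_diff_distrib sum_subtractf inner_sum_left)
      (simp add: e_def mult_delta_right)
  have "(\<Sum>t<T. (y t - z \<bullet> w t) * (h \<bullet> w t)) = 0" for h
  proof -
    have "(\<Sum>t<T. (y t - z \<bullet> w t) * (h \<bullet> w t))
        = (\<Sum>t<T. \<Sum>s<T. y s * (annihilator T w s t * (h \<bullet> w t)))"
      by (simp add: * sum_distrib_right mult.assoc)
    also have "\<dots> = (\<Sum>s<T. y s * (\<Sum>t<T. annihilator T w s t * (h \<bullet> w t)))"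
      by (subst sum.swap) (simp add: sum_distrib_left)
    also have "\<dots> = 0"
      by (simp add: annihilator_def resid_orthogonal)
    finally show ?thesis .
  qed
  from resid_unique[OF this assms] *[OF assms] show ?thesis by simp
qed

text \<open>Residuals are orthogonal to fitted values. This is the idempotence of the projection,
  from which the facts below about its entries follow.\<close>

lemma sum_resid_mult: "(\<Sum>t<T. resid T w x t * resid T w y t) = (\<Sum>t<T. resid T w x t * y t)"
  using resid_orthogonal[where y = x and h = "lsq T w y"]
  by (simp add: resid_def[where y = y] right_diff_distrib sum_subtractf)

lemma sum_annihilator_mult:
  assumes "s < T"
  shows "(\<Sum>r<T. resid T w y r * annihilator T w s r) = resid T w y s"
  unfolding annihilator_def sum_resid_mult using assms by (simp add: mult_delta_right)

text \<open>Both entries equal the inner product of the residuals of the two unit vectors.\<close>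

lemma annihilator_commute:
  assumes "s < T" "t < T"
  shows "annihilator T w s t = annihilator T w t s"
  using sum_annihilator_mult[OF assms(2), of w "\<lambda>t. if t = s then 1 else 0"]
    sum_annihilator_mult[OF assms(1), of w "\<lambda>r. if r = t then 1 else 0"]
  by (simp add: annihilator_def mult.commute)

text \<open>For a symmetric idempotent matrix the squared length of a row is its diagonal entry.
  Summed over rows, the squared Frobenius norm is the trace, which keeps the later second moment
  linear in \<open>N\<close>.\<close>

lemma sum_annihilator_square:
  assumes "s < T"
  shows "(\<Sum>t<T. (annihilator T w s t)\<^sup>2) = annihilator T w s s"
  using sum_annihilator_mult[OF assms, of w "\<lambda>t. if t = s then 1 else 0"]
  by (simp add: annihilator_def power2_eq_square)

text \<open>A diagonal entry \<open>p\<close> occurs among the squares of its own row, so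
  \<open>p * p \<le> p\<close> and hence \<open>p \<le> 1\<close>; the other squares in the row are
  at most \<open>p\<close>. Boundedness later makes all products of entries integrable.\<close>

lemma abs_annihilator_le_1:
  assumes "s < T" "t < T"
  shows "\<bar>annihilator T w s t\<bar> \<le> 1"
proof -
  have le: "(annihilator T w s r)\<^sup>2 \<le> annihilator T w s s" if "r < T" for r
    unfolding sum_annihilator_square[OF assms(1), of w, symmetric]
    using that by (intro member_le_sum) auto
  have "annihilator T w s s \<le> 1"
  proof (rule ccontr)
    assume "\<not> ?thesis"
    then have "annihilator T w s s * 1 < annihilator T w s s * annihilator T w s s"
      by (intro mult_strict_left_mono) auto
    then show False using le[OF assms(1)] by (simp add: power2_eq_square)
  qed
  then have "(annihilator T w s t)\<^sup>2 \<le> 1"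
    using le[OF assms(2)] by linarith
  then show ?thesis by (simp add: abs_square_le_1)
qed

section \<open>The residual sum of squares: quadratic form, minimality, degrees of freedom\<close>

lemma sum_resid_square:
  "(\<Sum>t<T. (resid T w y t)\<^sup>2) = (\<Sum>s<T. \<Sum>t<T. annihilator T w s t * (y s * y t))"
proof -
  have "(\<Sum>t<T. (resid T w y t)\<^sup>2) = (\<Sum>t<T. resid T w y t * y t)"
    using sum_resid_mult[of T w y y] by (simp add: power2_eq_square)
  also have "\<dots> = (\<Sum>t<T. \<Sum>s<T. annihilator T w s t * (y s * y t))"
    by (simp add: resid_eq_annihilator_sum sum_distrib_left mult_ac)
  finally show ?thesis by (subst sum.swap)
qed

text \<open>Pythagoras: changing the coefficients adds a fitted vector, to which the residuals are
  orthogonal.\<close>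

lemma resid_minimal: "(\<Sum>t<T. (resid T w y t)\<^sup>2) \<le> (\<Sum>t<T. (y t - z \<bullet> w t)\<^sup>2)"
proof -
  define h where "h = z - lsq T w y"
  have "(\<Sum>t<T. (y t - z \<bullet> w t)\<^sup>2)
      = (\<Sum>t<T. (resid T w y t)\<^sup>2 - 2 * (resid T w y t * (h \<bullet> w t)) + (h \<bullet> w t)\<^sup>2)"
    by (simp add: resid_def h_def inner_diff_left power2_eq_square algebra_simps)
  also have "\<dots> = (\<Sum>t<T. (resid T w y t)\<^sup>2) + (\<Sum>t<T. (h \<bullet> w t)\<^sup>2)"
    by (simp add: sum.distrib sum_subtractf sum_distrib_left[symmetric] resid_orthogonal)
  finally show ?thesis by (simp add: sum_nonneg)
qed

text \<open>This removes the intercepts and observed factors from the returns, so that only the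
  errors enter the estimator.\<close>

lemma resid_add_fitted:
  assumes "t < T"
  shows "resid T w (\<lambda>t. z \<bullet> w t + y t) t = resid T w y t"
proof -
  have "resid T w (\<lambda>t. z \<bullet> w t + y t) t = z \<bullet> w t + y t - (z + lsq T w y) \<bullet> w t"
    using resid_orthogonal[where y = y] assms
    by (intro resid_unique) (simp_all add: resid_def inner_add_left algebra_simps)
  then show ?thesis by (simp add: resid_def inner_add_left)
qed

text \<open>The trace of the complementary projection is that of the map sending \<open>b\<close> to
  the least squares coefficients of its fitted values. Injectivity of the design makes this map the
  identity.\<close>

lemma trace_annihilator:
  fixes w :: "nat \<Rightarrow> 'e::euclidean_space"
  assumes inj: "\<And>z. (\<And>t. t < T \<Longrightarrow> z \<bullet> w t = 0) \<Longrightarrow> z = 0"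
  shows "(\<Sum>t<T. annihilator T w t t) = real T - real DIM('e)"
proof -
  define e where "e s t = (if t = s then 1 else 0 :: real)" for s t :: nat
  have ann: "annihilator T w s t = e s t - lsq T w (e s) \<bullet> w t" for s t
    by (simp add: annihilator_def resid_def e_def[abs_def])
  have z_eq: "(\<Sum>t<T. (b \<bullet> w t) *\<^sub>R lsq T w (e t)) = b" for b
  proof -
    \<comment> \<open>A fitted vector has residual zero: it is a fitted part added to the zero
      vector.\<close>
    have "0 = (\<Sum>s<T. (b \<bullet> w s) * annihilator T w s t)" if "t < T" for t
      using resid_eq_annihilator_sum[OF that, of w "\<lambda>t. b \<bullet> w t"]
        resid_add_fitted[OF that, of w b "\<lambda>_. 0"] resid_eq_annihilator_sum[OF that, of w "\<lambda>_. 0"]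
      by simp
    then have "(b - (\<Sum>t<T. (b \<bullet> w t) *\<^sub>R lsq T w (e t))) \<bullet> w t = 0" if "t < T" for t
      using that
      by (simp add: ann right_diff_distrib sum_subtractf inner_diff_left inner_sum_left)
        (simp add: e_def mult_delta_right)
    from inj[OF this] show ?thesis by simp
  qed
  \<comment> \<open>Expanding in the basis and exchanging sums is the cyclic invariance of the
    trace.\<close>
  have "(\<Sum>t<T. lsq T w (e t) \<bullet> w t) = (\<Sum>t<T. \<Sum>b\<in>Basis. (lsq T w (e t) \<bullet> b) * (w t \<bullet> b))"
    by (subst euclidean_inner) simp
  also have "\<dots> = (\<Sum>b\<in>Basis. (\<Sum>t<T. (b \<bullet> w t) *\<^sub>R lsq T w (e t)) \<bullet> b)"
    by (subst sum.swap) (simp add: inner_sum_left inner_commute[of _ "w _"] mult.commute)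
  also have "\<dots> = real DIM('e)"
    by (simp add: z_eq inner_Basis)
  finally show ?thesis
    by (simp add: ann sum_subtractf) (simp add: e_def)
qed

text \<open>
  By polarisation the annihilator is obtained from residual sums of squares of fixed vectors, and these are
  infima over a countable dense set of coefficients; no rank condition on the design is needed.
\<close>

lemma measurable_annihilator:
  fixes w :: "'a \<Rightarrow> nat \<Rightarrow> 'e::euclidean_space"
  assumes w[measurable]: "\<And>t. (\<lambda>x. w x t) \<in> borel_measurable N" and st: "s < T" "t < T"
  shows "(\<lambda>x. annihilator T (w x) s t) \<in> borel_measurable N"
proof -
  obtain D :: "'e set" where D: "countable D" "\<And>X. open X \<Longrightarrow> X \<noteq> {} \<Longrightarrow> \<exists>d\<in>D. d \<in> X"
    using countable_dense_setE by metis
  define rss where "rss y v = (\<Sum>t<T. (resid T v y t)\<^sup>2)" for y and v :: "nat \<Rightarrow> 'e"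
  have "D \<noteq> {}" using D(2)[of UNIV] by auto
  have "rss y v = (INF z\<in>D. \<Sum>t<T. (y t - z \<bullet> v t)\<^sup>2)" for y v
  proof (rule antisym)
    show "rss y v \<le> (INF z\<in>D. \<Sum>t<T. (y t - z \<bullet> v t)\<^sup>2)"
      unfolding rss_def by (rule cINF_greatest[OF \<open>D \<noteq> {}\<close>]) (rule resid_minimal)
    show "(INF z\<in>D. \<Sum>t<T. (y t - z \<bullet> v t)\<^sup>2) \<le> rss y v"
    proof (rule field_le_epsilon)
      fix \<epsilon> :: real assume "0 < \<epsilon>"
      \<comment> \<open>The coefficients with nearly minimal sum of squares form an open set
        containing \<open>lsq T v y\<close>, so the dense set \<open>D\<close> meets it.\<close>
      let ?X = "{z. (\<Sum>t<T. (y t - z \<bullet> v t)\<^sup>2) < rss y v + \<epsilon>}"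
      have "open ?X"
        by (intro open_Collect_less continuous_intros)
      moreover have "lsq T v y \<in> ?X"
        using \<open>0 < \<epsilon>\<close> by (simp add: rss_def resid_def)
      ultimately obtain d where d: "d \<in> D" "d \<in> ?X"
        using D(2) by blast
      have "(INF z\<in>D. \<Sum>t<T. (y t - z \<bullet> v t)\<^sup>2) \<le> (\<Sum>t<T. (y t - d \<bullet> v t)\<^sup>2)"
        by (rule cINF_lower[OF _ d(1)]) (auto intro!: bdd_belowI2[of _ 0] sum_nonneg)
      with d(2) show "(INF z\<in>D. \<Sum>t<T. (y t - z \<bullet> v t)\<^sup>2) \<le> rss y v + \<epsilon>"
        by simp
    qed
  qed
  then have rss: "(\<lambda>x. rss y (w x)) \<in> borel_measurable N" for y
    using D(1) by simp
  define e where "e s t = (if t = s then 1 else 0 :: real)" for s t :: nat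
  have one: "rss (e s) v = annihilator T v s s" if "s < T" for v s
    unfolding rss_def e_def[abs_def] annihilator_def[symmetric] using that by (rule sum_annihilator_square)
  \<comment> \<open>Polarisation: the residual of the sum of two unit vectors is the sum of two
    rows, and their cross term is the entry \<open>(s, t)\<close>.\<close>
  have eq: "annihilator T v s t = (rss (\<lambda>r. e s r + e t r) v - rss (e s) v - rss (e t) v) / 2" for v
  proof -
    have "resid T v (\<lambda>r. e s r + e t r) r = annihilator T v s r + annihilator T v t r" if "r < T" for r
      using st that by (simp add: resid_eq_annihilator_sum e_def distrib_right sum.distrib mult_delta_left)
    then have "rss (\<lambda>r. e s r + e t r) v = (\<Sum>r<T. (annihilator T v s r)\<^sup>2 + (annihilator T v t r)\<^sup>2
       + 2 * (annihilator T v s r * annihilator T v t r))"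
      unfolding rss_def by (intro sum.cong) (auto simp: power2_eq_square algebra_simps)
    also have "\<dots> = annihilator T v s s + annihilator T v t t + 2 * annihilator T v s t"
      using sum_annihilator_mult[OF st(2), of v "\<lambda>t. if t = s then 1 else 0", folded annihilator_def]
      by (simp add: sum.distrib sum_annihilator_square st sum_distrib_left[symmetric])
    finally show ?thesis using st one by simp
  qed
  show ?thesis
    unfolding eq by (intro borel_measurable_divide borel_measurable_diff borel_measurable_const rss)
qed

subsection \<open>Independence\<close>

context prob_space
begin

lemma indep_of_prob:
  assumes "indep_of A X B Y" "E \<in> sets A" "F \<in> sets B"
  shows "prob ((X -` E \<inter> space M) \<inter> (Y -` F \<inter> space M))
    = prob (X -` E \<inter> space M) * prob (Y -` F \<inter> space M)"
  using assms unfolding indep_of_def by (intro indep_setD) auto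

lemma indep_of_compose:
  assumes XY: "indep_of A X B Y" and \<phi>: "\<phi> \<in> measurable A A'" and \<psi>: "\<psi> \<in> measurable B B'"
  shows "indep_of A' (\<lambda>\<omega>. \<phi> (X \<omega>)) B' (\<lambda>\<omega>. \<psi> (Y \<omega>))"
proof -
  have X: "X \<in> measurable M A" and Y: "Y \<in> measurable M B"
    and ind: "indep_set {X -` E \<inter> space M | E. E \<in> sets A} {Y -` E \<inter> space M | E. E \<in> sets B}"
    using XY by (auto simp: indep_of_def)
  have rv: "(\<lambda>\<omega>. \<phi> (X \<omega>)) \<in> measurable M A'" "(\<lambda>\<omega>. \<psi> (Y \<omega>)) \<in> measurable M B'"
    using measurable_compose[OF X \<phi>] measurable_compose[OF Y \<psi>] by auto
  have X': "(\<lambda>\<omega>. \<phi> (X \<omega>)) -` E \<inter> space M = X -` (\<phi> -` E \<inter> space A) \<inter> space M" for E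
    using measurable_space[OF X] by auto
  have Y': "(\<lambda>\<omega>. \<psi> (Y \<omega>)) -` E \<inter> space M = Y -` (\<psi> -` E \<inter> space B) \<inter> space M" for E
    using measurable_space[OF Y] by auto
  show ?thesis
    unfolding indep_of_def
  proof (intro conjI rv indep_setI)
    fix a b
    assume "a \<in> {(\<lambda>\<omega>. \<phi> (X \<omega>)) -` E \<inter> space M | E. E \<in> sets A'}"
      and "b \<in> {(\<lambda>\<omega>. \<psi> (Y \<omega>)) -` E \<inter> space M | E. E \<in> sets B'}"
    then obtain E F where "E \<in> sets A'" "F \<in> sets B'"
      and "a = X -` (\<phi> -` E \<inter> space A) \<inter> space M" "b = Y -` (\<psi> -` F \<inter> space B) \<inter> space M"
      unfolding X' Y' by blast
    then show "prob (a \<inter> b) = prob a * prob b"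
      using indep_of_prob[OF XY measurable_sets[OF \<phi>] measurable_sets[OF \<psi>]] by metis
  qed (use rv in \<open>auto intro: measurable_sets\<close>)
qed

lemma Int_stable_vimage: "Int_stable {Z -` E \<inter> space M | E. E \<in> sets N}"
proof (rule Int_stableI)
  fix E F
  assume "E \<in> {Z -` E \<inter> space M | E. E \<in> sets N}" "F \<in> {Z -` E \<inter> space M | E. E \<in> sets N}"
  then obtain a b where "a \<in> sets N" "b \<in> sets N" "E = Z -` a \<inter> space M" "F = Z -` b \<inter> space M"
    by blast
  then show "E \<inter> F \<in> {Z -` E \<inter> space M | E. E \<in> sets N}"
    by (intro CollectI exI[of _ "a \<inter> b"]) auto
qed

text \<open>Both value types coincide here. After composition with real functions this gives the
  product rule for expectations of elements of different types.\<close>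

lemma indep_of_imp_indep_var:
  assumes "indep_of A X B Y"
  shows "indep_var A X B Y"
  unfolding indep_var_eq
  using assms by (intro conjI indep_set_sigma_sets Int_stable_vimage) (simp_all add: indep_of_def)

lemma
  fixes \<phi> :: "'b \<Rightarrow> real" and \<psi> :: "'c \<Rightarrow> real"
  assumes "indep_of A X B Y" "\<phi> \<in> borel_measurable A" "\<psi> \<in> borel_measurable B"
    and "integrable M (\<lambda>\<omega>. \<phi> (X \<omega>))" "integrable M (\<lambda>\<omega>. \<psi> (Y \<omega>))"
  shows indep_of_integrable_mult: "integrable M (\<lambda>\<omega>. \<phi> (X \<omega>) * \<psi> (Y \<omega>))"
    and indep_of_expectation_mult:
      "expectation (\<lambda>\<omega>. \<phi> (X \<omega>) * \<psi> (Y \<omega>)) = expectation (\<lambda>\<omega>. \<phi> (X \<omega>)) * expectation (\<lambda>\<omega>. \<psi> (Y \<omega>))"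
  using indep_of_imp_indep_var[OF indep_of_compose[OF assms(1-3)]] assms(4,5)
  by (auto intro: indep_var_integrable indep_var_lebesgue_integral)

text \<open>One period is split off from a block of other periods. The block enters as a restricted
  path, so that \<open>\<psi>\<close> may combine several periods.\<close>

lemma indep_vars_expectation_mult:
  fixes \<phi> :: "'b \<Rightarrow> real"
  assumes X: "indep_vars N X I" and "s \<in> I" "B \<subseteq> I" "s \<notin> B"
    and \<phi>: "\<phi> \<in> borel_measurable (N s)" and \<psi>: "\<psi> \<in> borel_measurable (PiM B N)"
    and int: "integrable M (\<lambda>\<omega>. \<phi> (X s \<omega>))" "integrable M (\<lambda>\<omega>. \<psi> (\<lambda>t\<in>B. X t \<omega>))"
  shows "expectation (\<lambda>\<omega>. \<phi> (X s \<omega>) * \<psi> (\<lambda>t\<in>B. X t \<omega>))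
    = expectation (\<lambda>\<omega>. \<phi> (X s \<omega>)) * expectation (\<lambda>\<omega>. \<psi> (\<lambda>t\<in>B. X t \<omega>))"
proof -
  have "indep_var (PiM {s} N) (\<lambda>\<omega>. \<lambda>t\<in>{s}. X t \<omega>) (PiM B N) (\<lambda>\<omega>. \<lambda>t\<in>B. X t \<omega>)"
    using assms by (intro indep_var_restrict[OF X]) auto
  from indep_var_compose[OF this _ \<psi>, of "\<lambda>x. \<phi> (x s)" borel]
  have "indep_var borel (\<lambda>\<omega>. \<phi> (X s \<omega>)) borel (\<lambda>\<omega>. \<psi> (\<lambda>t\<in>B. X t \<omega>))"
    using measurable_compose[OF measurable_component_singleton[of s "{s}" N] \<phi>]
    by (simp add: comp_def)
  from indep_var_lebesgue_integral[OF this int] show ?thesis .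
qed

section \<open>Independence of pairs\<close>

text \<open>The product sigma-algebra is generated by rectangles, and taking preimages commutes with
  generation.\<close>

lemma vimage_pair_subset_sigma_sets:
  assumes X: "X \<in> measurable M A" and Y: "Y \<in> measurable M B"
  shows "{(\<lambda>\<omega>. (X \<omega>, Y \<omega>)) -` E \<inter> space M | E. E \<in> sets (A \<Otimes>\<^sub>M B)}
    \<subseteq> sigma_sets (space M) {(X -` a \<inter> space M) \<inter> (Y -` b \<inter> space M) | a b. a \<in> sets A \<and> b \<in> sets B}"
proof -
  let ?Z = "\<lambda>\<omega>. (X \<omega>, Y \<omega>)"
  have "?Z \<in> space M \<rightarrow> space A \<times> space B"
    using measurable_space[OF X] measurable_space[OF Y] by auto
  from sigma_sets_vimage_commute[OF this, of "{a \<times> b | a b. a \<in> sets A \<and> b \<in> sets B}"]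
  have "{?Z -` E \<inter> space M | E. E \<in> sets (A \<Otimes>\<^sub>M B)}
      = sigma_sets (space M) {?Z -` E \<inter> space M | E. E \<in> {a \<times> b | a b. a \<in> sets A \<and> b \<in> sets B}}"
    by (simp add: sets_pair_measure)
  also have "\<dots> \<subseteq> sigma_sets (space M) {(X -` a \<inter> space M) \<inter> (Y -` b \<inter> space M) | a b. a \<in> sets A \<and> b \<in> sets B}"
    by (intro sigma_sets_subseteq) blast
  finally show ?thesis .
qed

lemma Int_stable_vimage_rectangles:
  "Int_stable {(X -` a \<inter> space M) \<inter> (Y -` b \<inter> space M) | a b. a \<in> sets A \<and> b \<in> sets B}"
proof (rule Int_stableI)
  fix E F
  assume "E \<in> {(X -` a \<inter> space M) \<inter> (Y -` b \<inter> space M) | a b. a \<in> sets A \<and> b \<in> sets B}"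
    and "F \<in> {(X -` a \<inter> space M) \<inter> (Y -` b \<inter> space M) | a b. a \<in> sets A \<and> b \<in> sets B}"
  then obtain a b a' b'
    where "a \<in> sets A" "b \<in> sets B" "a' \<in> sets A" "b' \<in> sets B"
      and "E = (X -` a \<inter> space M) \<inter> (Y -` b \<inter> space M)" "F = (X -` a' \<inter> space M) \<inter> (Y -` b' \<inter> space M)"
    by blast
  then show "E \<inter> F \<in> {(X -` a \<inter> space M) \<inter> (Y -` b \<inter> space M) | a b. a \<in> sets A \<and> b \<in> sets B}"
    by (intro CollectI exI[of _ "a \<inter> a'"] exI[of _ "b \<inter> b'"]) auto
qed

text \<open>On rectangles the probabilities split into three factors, and rectangles form an
  intersection-stable generator. It is applied with idiosyncratic errors, latent factor and observed
  factors as \<open>X\<close>, \<open>Y\<close>, \<open>Z\<close>.\<close>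

lemma indep_of_Pair:
  assumes X_YZ: "indep_of A X (B \<Otimes>\<^sub>M C) (\<lambda>\<omega>. (Y \<omega>, Z \<omega>))" and YZ: "indep_of B Y C Z"
  shows "indep_of (A \<Otimes>\<^sub>M B) (\<lambda>\<omega>. (X \<omega>, Y \<omega>)) C Z"
proof -
  let ?R = "{(X -` a \<inter> space M) \<inter> (Y -` b \<inter> space M) | a b. a \<in> sets A \<and> b \<in> sets B}"
  let ?S = "{Z -` E \<inter> space M | E. E \<in> sets C}"
  have X: "X \<in> measurable M A" and Y: "Y \<in> measurable M B" and Z: "Z \<in> measurable M C"
    using assms by (auto simp: indep_of_def)
  have "indep_set ?R ?S"
  proof (rule indep_setI)
    fix E F assume "E \<in> ?R" "F \<in> ?S"
    then obtain a b c where abc: "a \<in> sets A" "b \<in> sets B" "c \<in> sets C"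
      and E: "E = (X -` a \<inter> space M) \<inter> (Y -` b \<inter> space M)" and F: "F = Z -` c \<inter> space M"
      by blast
    \<comment> \<open>The choice \<open>space C\<close> for the second side recovers the
      independence of \<open>X\<close> and \<open>Y\<close>.\<close>
    let ?YZ = "\<lambda>c. (\<lambda>\<omega>. (Y \<omega>, Z \<omega>)) -` (b \<times> c) \<inter> space M"
    have "Y -` b \<inter> space M = ?YZ (space C)"
      using measurable_space[OF Z] by auto
    then have "prob E = prob (X -` a \<inter> space M) * prob (Y -` b \<inter> space M)"
      unfolding E using indep_of_prob[OF X_YZ abc(1), of "b \<times> space C"] abc by simp
    moreover have "E \<inter> F = (X -` a \<inter> space M) \<inter> ?YZ c"
      unfolding E F by auto
    then have "prob (E \<inter> F) = prob (X -` a \<inter> space M) * prob (?YZ c)"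
      using indep_of_prob[OF X_YZ abc(1), of "b \<times> c"] abc by simp
    moreover have "?YZ c = (Y -` b \<inter> space M) \<inter> (Z -` c \<inter> space M)"
      by auto
    then have "prob (?YZ c) = prob (Y -` b \<inter> space M) * prob F"
      unfolding F using indep_of_prob[OF YZ abc(2,3)] by simp
    ultimately show "prob (E \<inter> F) = prob E * prob F" by simp
  qed (use X Y Z in \<open>auto intro!: sets.Int measurable_sets\<close>)
  then have "indep_set (sigma_sets (space M) ?R) (sigma_sets (space M) ?S)"
    by (rule indep_set_sigma_sets[OF _ Int_stable_vimage_rectangles Int_stable_vimage])
  then have "indep_set {(\<lambda>\<omega>. (X \<omega>, Y \<omega>)) -` E \<inter> space M | E. E \<in> sets (A \<Otimes>\<^sub>M B)} ?S"
    unfolding indep_set_def using vimage_pair_subset_sigma_sets[OF X Y]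
    by (elim indep_sets_mono_sets) (auto split: bool.split)
  then show ?thesis
    using X Y Z by (simp add: indep_of_def)
qed

text \<open>For finitely many periods, mutual independence of the processes separates the
  \<open>X\<close> events from the \<open>Y\<close> events, and serial independence then factors
  each group. Rectangles generate, as before.\<close>

lemma indep_vars_Pair:
  assumes X: "indep_vars A X UNIV" and Y: "indep_vars B Y UNIV"
    and XY: "indep_of (PiM UNIV A) (\<lambda>\<omega> t. X t \<omega>) (PiM UNIV B) (\<lambda>\<omega> t. Y t \<omega>)"
  shows "indep_vars (\<lambda>t. A t \<Otimes>\<^sub>M B t) (\<lambda>t \<omega>. (X t \<omega>, Y t \<omega>)) UNIV"
proof -
  let ?R = "\<lambda>t. {(X t -` a \<inter> space M) \<inter> (Y t -` b \<inter> space M) | a b. a \<in> sets (A t) \<and> b \<in> sets (B t)}"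
  have rv: "X t \<in> measurable M (A t)" "Y t \<in> measurable M (B t)" for t
    using X Y by (auto simp: indep_vars_def)
  have prod: "prob ((\<Inter>t\<in>J. X t -` a t \<inter> space M) \<inter> (\<Inter>t\<in>J. Y t -` b t \<inter> space M))
      = (\<Prod>t\<in>J. prob (X t -` a t \<inter> space M)) * (\<Prod>t\<in>J. prob (Y t -` b t \<inter> space M))"
    if J: "finite J" "J \<noteq> {}" and ab: "\<forall>t\<in>J. a t \<in> sets (A t) \<and> b t \<in> sets (B t)" for J a b
  proof -
    let ?E = "{x \<in> space (PiM UNIV A). \<forall>t\<in>J. x t \<in> a t}"
    let ?F = "{x \<in> space (PiM UNIV B). \<forall>t\<in>J. x t \<in> b t}"
    have E: "?E \<in> sets (PiM UNIV A)" and F: "?F \<in> sets (PiM UNIV B)"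
      using J ab by (auto intro!: sets.sets_Collect_finite_All' measurable_sets_Collect[OF measurable_component_singleton])
    have EJ: "(\<lambda>\<omega> t. X t \<omega>) -` ?E \<inter> space M = (\<Inter>t\<in>J. X t -` a t \<inter> space M)"
      using J measurable_space[OF rv(1)] by (auto simp: space_PiM)
    have FJ: "(\<lambda>\<omega> t. Y t \<omega>) -` ?F \<inter> space M = (\<Inter>t\<in>J. Y t -` b t \<inter> space M)"
      using J measurable_space[OF rv(2)] by (auto simp: space_PiM)
    show ?thesis
      unfolding indep_of_prob[OF XY E F, unfolded EJ FJ]
      using indep_varsD[OF X, of J a] indep_varsD[OF Y, of J b] J ab by simp
  qed
  have "indep_sets ?R UNIV"
  proof (rule indep_setsI)
    fix E J assume J: "J \<noteq> {}" "finite J" and "\<forall>t\<in>J. E t \<in> ?R t"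
    then have "\<forall>t\<in>J. \<exists>a b. E t = (X t -` a \<inter> space M) \<inter> (Y t -` b \<inter> space M)
        \<and> a \<in> sets (A t) \<and> b \<in> sets (B t)"
      unfolding mem_Collect_eq by - assumption
    then obtain a b where ab: "\<forall>t\<in>J. a t \<in> sets (A t) \<and> b t \<in> sets (B t)"
      and E: "\<forall>t\<in>J. E t = (X t -` a t \<inter> space M) \<inter> (Y t -` b t \<inter> space M)"
      by metis
    have "(\<Inter>t\<in>J. E t) = (\<Inter>t\<in>J. (X t -` a t \<inter> space M) \<inter> (Y t -` b t \<inter> space M))"
      using E by (intro INF_cong) auto
    also have "\<dots> = (\<Inter>t\<in>J. X t -` a t \<inter> space M) \<inter> (\<Inter>t\<in>J. Y t -` b t \<inter> space M)"
      by (rule INF_inf_distrib[symmetric])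
    finally have "(\<Inter>t\<in>J. E t) = (\<Inter>t\<in>J. X t -` a t \<inter> space M) \<inter> (\<Inter>t\<in>J. Y t -` b t \<inter> space M)" .
    \<comment> \<open>The case of a single period gives the factorisation of each event on the
      right-hand side.\<close>
    moreover have "prob (E t) = prob (X t -` a t \<inter> space M) * prob (Y t -` b t \<inter> space M)" if "t \<in> J" for t
      using prod[of "{t}" a b] ab that by (simp add: bspec[OF E that])
    ultimately show "prob (\<Inter>t\<in>J. E t) = (\<Prod>t\<in>J. prob (E t))"
      using prod[OF J(2,1) ab] by (simp add: prod.distrib)
  qed (use rv in \<open>auto intro!: sets.Int measurable_sets\<close>)
  then have "indep_sets (\<lambda>t. sigma_sets (space M) (?R t)) UNIV"
    by (rule indep_sets_sigma) (rule Int_stable_vimage_rectangles)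
  then have "indep_sets (\<lambda>t. {(\<lambda>\<omega>. (X t \<omega>, Y t \<omega>)) -` E \<inter> space M | E. E \<in> sets (A t \<Otimes>\<^sub>M B t)}) UNIV"
    by (rule indep_sets_mono_sets) (rule vimage_pair_subset_sigma_sets[OF rv])
  then show ?thesis
    using rv by (simp add: indep_vars_def2)
qed

end

subsection \<open>Quadratic forms in serially independent errors\<close>

text \<open>Two rounds of the arithmetic-geometric mean inequality. The bound serves as an
  integrable majorant under finite fourth moments.\<close>

lemma abs_mult4_le:
  fixes a b c d :: real
  shows "\<bar>a * b * c * d\<bar> \<le> a ^ 4 + b ^ 4 + c ^ 4 + d ^ 4"
proof -
  have "2 * \<bar>a * b * c * d\<bar> \<le> (a * b)\<^sup>2 + (c * d)\<^sup>2"
    using sum_squares_bound[of "\<bar>a * b\<bar>" "\<bar>c * d\<bar>"] by (simp add: abs_mult power_mult_distrib mult.assoc)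
  moreover have "2 * (a * b)\<^sup>2 \<le> a ^ 4 + b ^ 4"
    using sum_squares_bound[of "a\<^sup>2" "b\<^sup>2"] by (simp add: power_mult_distrib power_mult[symmetric])
  moreover have "2 * (c * d)\<^sup>2 \<le> c ^ 4 + d ^ 4"
    using sum_squares_bound[of "c\<^sup>2" "d\<^sup>2"] by (simp add: power_mult_distrib power_mult[symmetric])
  ultimately have *: "4 * \<bar>a * b * c * d\<bar> \<le> a ^ 4 + b ^ 4 + (c ^ 4 + d ^ 4)"
    by linarith
  have "0 \<le> a ^ 4 + b ^ 4 + (c ^ 4 + d ^ 4)" by simp
  with * show ?thesis by linarith
qed

lemma measurable_component_component:
  assumes "t \<in> B"
  shows "(\<lambda>x. x t i) \<in> borel_measurable (\<Pi>\<^sub>M t\<in>B. \<Pi>\<^sub>M i\<in>UNIV. (borel :: 'b::topological_space measure))"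
proof -
  have "(\<lambda>y. y i) \<in> borel_measurable (\<Pi>\<^sub>M i\<in>UNIV. (borel :: 'b measure))"
    by (rule measurable_component_singleton) simp
  from measurable_compose[OF measurable_component_singleton[OF assms] this] show ?thesis .
qed

context prob_space
begin

lemma integrable_mult4:
  fixes a b c d :: "'a \<Rightarrow> real"
  assumes [measurable]: "random_variable borel a" "random_variable borel b"
      "random_variable borel c" "random_variable borel d"
    and "integrable M (\<lambda>\<omega>. a \<omega> ^ 4)" "integrable M (\<lambda>\<omega>. b \<omega> ^ 4)"
      "integrable M (\<lambda>\<omega>. c \<omega> ^ 4)" "integrable M (\<lambda>\<omega>. d \<omega> ^ 4)"
  shows "integrable M (\<lambda>\<omega>. a \<omega> * b \<omega> * c \<omega> * d \<omega>)"
proof (rule Bochner_Integration.integrable_bound)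
  show "integrable M (\<lambda>\<omega>. a \<omega> ^ 4 + b \<omega> ^ 4 + c \<omega> ^ 4 + d \<omega> ^ 4)"
    using assms by auto
  have "\<bar>a \<omega> * b \<omega> * c \<omega> * d \<omega>\<bar> \<le> \<bar>a \<omega> ^ 4 + b \<omega> ^ 4 + c \<omega> ^ 4 + d \<omega> ^ 4\<bar>" for \<omega>
    using abs_mult4_le order_trans abs_ge_self by blast
  then show "AE \<omega> in M. norm (a \<omega> * b \<omega> * c \<omega> * d \<omega>) \<le> norm (a \<omega> ^ 4 + b \<omega> ^ 4 + c \<omega> ^ 4 + d \<omega> ^ 4)"
    by simp
qed auto

text \<open>Missing factors are filled up by the constant 1, which is integrable under a probability
  measure.\<close>

lemma integrable_le_mult4:
  fixes a b c :: "'a \<Rightarrow> real"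
  assumes "random_variable borel a" "integrable M (\<lambda>\<omega>. a \<omega> ^ 4)"
    and "random_variable borel b" "integrable M (\<lambda>\<omega>. b \<omega> ^ 4)"
    and "random_variable borel c" "integrable M (\<lambda>\<omega>. c \<omega> ^ 4)"
  shows "integrable M a" "integrable M (\<lambda>\<omega>. a \<omega> * b \<omega>)" "integrable M (\<lambda>\<omega>. a \<omega> * b \<omega> * c \<omega>)"
  using integrable_mult4[of a "\<lambda>_. 1" "\<lambda>_. 1" "\<lambda>_. 1"] integrable_mult4[of a b "\<lambda>_. 1" "\<lambda>_. 1"]
    integrable_mult4[of a b c "\<lambda>_. 1"] assms by auto

text \<open>In the expanded square, orthogonality leaves for each index pair only the pair itself
  and its transpose. Both contribute the same by symmetry, whence the factor 2.\<close>

lemma expectation_weighted_sum_square_le: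
  fixes P W :: "nat \<Rightarrow> nat \<Rightarrow> 'a \<Rightarrow> real"
  assumes P_rv: "\<And>s t. s < T \<Longrightarrow> t < T \<Longrightarrow> random_variable borel (P s t)"
    and P_bound: "\<And>s t \<omega>. s < T \<Longrightarrow> t < T \<Longrightarrow> \<bar>P s t \<omega>\<bar> \<le> 1"
    and P_commute: "\<And>s t \<omega>. s < T \<Longrightarrow> t < T \<Longrightarrow> P s t \<omega> = P t s \<omega>"
    and W_commute: "\<And>s t \<omega>. W s t \<omega> = W t s \<omega>"
    and integrable: "\<And>s t s' t'. s < T \<Longrightarrow> t < T \<Longrightarrow> s' < T \<Longrightarrow> t' < T \<Longrightarrow>
      integrable M (\<lambda>\<omega>. (P s t \<omega> * P s' t' \<omega>) * (W s t \<omega> * W s' t' \<omega>))"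
    and factor: "\<And>s t s' t'. s < T \<Longrightarrow> t < T \<Longrightarrow> s' < T \<Longrightarrow> t' < T \<Longrightarrow>
      expectation (\<lambda>\<omega>. (P s t \<omega> * P s' t' \<omega>) * (W s t \<omega> * W s' t' \<omega>))
        = expectation (\<lambda>\<omega>. P s t \<omega> * P s' t' \<omega>) * expectation (\<lambda>\<omega>. W s t \<omega> * W s' t' \<omega>)"
    and orthogonal: "\<And>s t s' t'. {s, t} \<noteq> {s', t'} \<Longrightarrow> expectation (\<lambda>\<omega>. W s t \<omega> * W s' t' \<omega>) = 0"
    and W_bound: "\<And>s t. expectation (\<lambda>\<omega>. (W s t \<omega>)\<^sup>2) \<le> B"
  shows "integrable M (\<lambda>\<omega>. (\<Sum>s<T. \<Sum>t<T. P s t \<omega> * W s t \<omega>)\<^sup>2)"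
    and "expectation (\<lambda>\<omega>. (\<Sum>s<T. \<Sum>t<T. P s t \<omega> * W s t \<omega>)\<^sup>2)
      \<le> 2 * B * expectation (\<lambda>\<omega>. \<Sum>s<T. \<Sum>t<T. (P s t \<omega>)\<^sup>2)"
proof -
  let ?I = "{..<T} \<times> {..<T}"
  define p where "p q = P (fst q) (snd q)" for q
  define w where "w q = W (fst q) (snd q)" for q
  have eq: "(\<Sum>s<T. \<Sum>t<T. P s t \<omega> * W s t \<omega>)\<^sup>2
      = (\<Sum>q\<in>?I. \<Sum>q'\<in>?I. (p q \<omega> * p q' \<omega>) * (w q \<omega> * w q' \<omega>))" for \<omega>
    by (simp add: sum.cartesian_product case_prod_beta power2_eq_square sum_product p_def w_def mult_ac)
  have int: "integrable M (\<lambda>\<omega>. (p q \<omega> * p q' \<omega>) * (w q \<omega> * w q' \<omega>))" if "q \<in> ?I" "q' \<in> ?I" for q q'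
    using integrable that by (auto simp: p_def w_def)
  then show "integrable M (\<lambda>\<omega>. (\<Sum>s<T. \<Sum>t<T. P s t \<omega> * W s t \<omega>)\<^sup>2)"
    unfolding eq by (intro Bochner_Integration.integrable_sum)
  have "0 \<le> expectation (\<lambda>\<omega>. (W 0 0 \<omega>)\<^sup>2)" by simp
  then have "0 \<le> B" using W_bound order_trans by blast
  have p_int: "integrable M (\<lambda>\<omega>. (p q \<omega>)\<^sup>2)" if "q \<in> ?I" for q
    using that P_rv P_bound
    by (intro integrable_const_bound[where B = 1]) (auto simp: p_def abs_square_le_1)
  have row: "(\<Sum>q'\<in>?I. expectation (\<lambda>\<omega>. (p q \<omega> * p q' \<omega>) * (w q \<omega> * w q' \<omega>)))
      \<le> 2 * B * expectation (\<lambda>\<omega>. (p q \<omega>)\<^sup>2)" if q_in: "q \<in> ?I" for q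
  proof -
    obtain s t where q: "q = (s, t)" "s < T" "t < T" using q_in by auto
    have "(\<Sum>q'\<in>?I. expectation (\<lambda>\<omega>. (p q \<omega> * p q' \<omega>) * (w q \<omega> * w q' \<omega>)))
        = (\<Sum>q'\<in>{(s, t), (t, s)}. expectation (\<lambda>\<omega>. (p q \<omega> * p q' \<omega>) * (w q \<omega> * w q' \<omega>)))"
    proof (rule sum.mono_neutral_right)
      show "\<forall>q'\<in>?I - {(s, t), (t, s)}. expectation (\<lambda>\<omega>. (p q \<omega> * p q' \<omega>) * (w q \<omega> * w q' \<omega>)) = 0"
      proof
        fix q' assume q': "q' \<in> ?I - {(s, t), (t, s)}"
        then obtain s' t' where "q' = (s', t')" "s' < T" "t' < T" by auto
        moreover from this q' have "{s, t} \<noteq> {s', t'}" by (auto simp: doubleton_eq_iff)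
        ultimately show "expectation (\<lambda>\<omega>. (p q \<omega> * p q' \<omega>) * (w q \<omega> * w q' \<omega>)) = 0"
          using q by (simp add: p_def w_def factor orthogonal)
      qed
    qed (use q in auto)
    also have "\<dots> \<le> (\<Sum>q'\<in>{(s, t), (t, s)}. B * expectation (\<lambda>\<omega>. (p q \<omega>)\<^sup>2))"
    proof (rule sum_mono)
      fix q' assume q': "q' \<in> {(s, t), (t, s)}"
      then have "p q' \<omega> = p q \<omega>" "w q' \<omega> = w q \<omega>" for \<omega>
        using q P_commute[of s t] W_commute[of s t] by (auto simp: p_def w_def)
      then have "expectation (\<lambda>\<omega>. (p q \<omega> * p q' \<omega>) * (w q \<omega> * w q' \<omega>))
          = expectation (\<lambda>\<omega>. (p q \<omega>)\<^sup>2) * expectation (\<lambda>\<omega>. (w q \<omega>)\<^sup>2)"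
        using q factor[of s t s t] by (simp add: p_def w_def power2_eq_square)
      also have "\<dots> \<le> expectation (\<lambda>\<omega>. (p q \<omega>)\<^sup>2) * B"
        using W_bound by (intro mult_left_mono) (auto simp: w_def)
      finally show "expectation (\<lambda>\<omega>. (p q \<omega> * p q' \<omega>) * (w q \<omega> * w q' \<omega>)) \<le> B * expectation (\<lambda>\<omega>. (p q \<omega>)\<^sup>2)"
        by (simp add: mult.commute)
    qed
    \<comment> \<open>For \<open>s = t\<close> the two pairs coincide and there is one term only;
      doubling it is harmless as \<open>0 \<le> B\<close>.\<close>
    also have "\<dots> \<le> 2 * B * expectation (\<lambda>\<omega>. (p q \<omega>)\<^sup>2)"
      using \<open>0 \<le> B\<close> by (cases "s = t") auto
    finally show ?thesis .
  qed
  have "expectation (\<lambda>\<omega>. (\<Sum>s<T. \<Sum>t<T. P s t \<omega> * W s t \<omega>)\<^sup>2)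
      = (\<Sum>q\<in>?I. \<Sum>q'\<in>?I. expectation (\<lambda>\<omega>. (p q \<omega> * p q' \<omega>) * (w q \<omega> * w q' \<omega>)))"
    unfolding eq using int by (simp add: Bochner_Integration.integral_sum Bochner_Integration.integrable_sum)
  also have "\<dots> \<le> (\<Sum>q\<in>?I. 2 * B * expectation (\<lambda>\<omega>. (p q \<omega>)\<^sup>2))"
    by (intro sum_mono row)
  also have "\<dots> = 2 * B * expectation (\<lambda>\<omega>. \<Sum>q\<in>?I. (p q \<omega>)\<^sup>2)"
    using p_int by (simp add: Bochner_Integration.integral_sum sum_distrib_left)
  also have "(\<lambda>\<omega>. \<Sum>q\<in>?I. (p q \<omega>)\<^sup>2) = (\<lambda>\<omega>. \<Sum>s<T. \<Sum>t<T. (P s t \<omega>)\<^sup>2)"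
    by (simp add: sum.cartesian_product case_prod_beta p_def)
  finally show "expectation (\<lambda>\<omega>. (\<Sum>s<T. \<Sum>t<T. P s t \<omega> * W s t \<omega>)\<^sup>2)
      \<le> 2 * B * expectation (\<lambda>\<omega>. \<Sum>s<T. \<Sum>t<T. (P s t \<omega>)\<^sup>2)" .
qed

text \<open>Either some period occurs exactly once among the four, and its mean-zero error factors
  out, or both pairs are diagonal at distinct periods, and two independent centred variables are
  multiplied.\<close>

lemma cross_product_orthogonal:
  fixes u :: "nat \<Rightarrow> nat \<Rightarrow> 'a \<Rightarrow> real" and c :: "nat \<Rightarrow> nat \<Rightarrow> real"
    and W :: "nat \<Rightarrow> nat \<Rightarrow> 'a \<Rightarrow> real"
  assumes W_def: "\<And>s t \<omega>. W s t \<omega> = (\<Sum>i<n. u i s \<omega> * u i t \<omega>) - c s t"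
    and serial: "indep_vars (\<lambda>_. \<Pi>\<^sub>M i\<in>UNIV. borel) (\<lambda>t \<omega> i. u i t \<omega>) UNIV"
    and u4: "\<And>i t. integrable M (\<lambda>\<omega>. u i t \<omega> ^ 4)"
    and mean: "\<And>i t. expectation (u i t) = 0"
    and c: "\<And>t. c t t = (\<Sum>i<n. expectation (\<lambda>\<omega>. (u i t \<omega>)\<^sup>2))"
      "\<And>s t. s \<noteq> t \<Longrightarrow> c s t = 0"
    and ne: "{s, t} \<noteq> {s', t'}"
  shows "expectation (\<lambda>\<omega>. W s t \<omega> * W s' t' \<omega>) = 0"
proof -
  have rv[measurable]: "random_variable borel (u i t)" for i t
  proof -
    have "(\<lambda>\<omega> i. u i t \<omega>) \<in> M \<rightarrow>\<^sub>M (\<Pi>\<^sub>M i\<in>UNIV. borel)"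
      using serial by (auto simp: indep_vars_def)
    from measurable_compose[OF this measurable_component_singleton[of i]] show ?thesis by simp
  qed
  note int4 = integrable_mult4[OF rv rv rv rv u4 u4 u4 u4]
  note int3 = integrable_le_mult4[OF rv u4 rv u4 rv u4]
  have W_commute: "W s t = W t s" for s t
    using c(2) by (cases "s = t") (auto simp: W_def fun_eq_iff mult.commute)
  \<comment> \<open>The periods \<open>t\<close>, \<open>s'\<close>, \<open>t'\<close> may coincide;
    they form the block from which \<open>s\<close> is split off.\<close>
  have single: "expectation (\<lambda>\<omega>. W s t \<omega> * W s' t' \<omega>) = 0" if s: "s \<notin> {t, s', t'}" for s t s' t'
  proof -
    let ?\<psi> = "\<lambda>i x. x t i * ((\<Sum>j<n. x s' j * x t' j) - c s' t') :: real"
    have \<psi>: "?\<psi> i \<in> borel_measurable (\<Pi>\<^sub>M t\<in>{t, s', t'}. \<Pi>\<^sub>M i\<in>UNIV. borel)" for i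
      by (intro borel_measurable_times borel_measurable_diff borel_measurable_sum
          measurable_component_component borel_measurable_const) auto
    have int\<psi>: "integrable M (\<lambda>\<omega>. u i t \<omega> * W s' t' \<omega>)" for i
      using int3 by (simp add: W_def right_diff_distrib sum_distrib_left mult.assoc[symmetric])
    have intu: "integrable M (\<lambda>\<omega>. u i s \<omega> * (u i t \<omega> * W s' t' \<omega>))" for i
      using int4 int3
      by (simp add: W_def right_diff_distrib sum_distrib_left mult.assoc[symmetric])
    have "expectation (\<lambda>\<omega>. u i s \<omega> * (u i t \<omega> * W s' t' \<omega>)) = 0" for i
      using indep_vars_expectation_mult[OF serial UNIV_I subset_UNIV s
          measurable_component_singleton[of i UNIV "\<lambda>_. borel"] \<psi>[of i]] int3(1) int\<psi>[of i]
      by (simp add: W_def mean)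
    \<comment> \<open>Since \<open>s\<close> differs from \<open>t\<close>, there is no centring
      term in \<open>W s t\<close>, and every summand carries the factor
      \<open>u i s\<close>.\<close>
    moreover have "W s t \<omega> * W s' t' \<omega> = (\<Sum>i<n. u i s \<omega> * (u i t \<omega> * W s' t' \<omega>))" for \<omega>
      using s c(2)[of s t] by (simp add: W_def[of s t] sum_distrib_right mult.assoc)
    ultimately show ?thesis
      using intu by (simp add: Bochner_Integration.integral_sum)
  qed
  have diag: "expectation (\<lambda>\<omega>. W s s \<omega> * W r r \<omega>) = 0" if "s \<noteq> r" for s r
  proof -
    have W_eq: "W t t \<omega> = (\<lambda>x. (\<Sum>i<n. x i * x i) - c t t) (\<lambda>i. u i t \<omega>)" for t \<omega>
      by (simp add: W_def)
    have "integrable M (\<lambda>\<omega>. W t t \<omega>)" for t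
      using int3 by (simp add: W_def)
    moreover have "expectation (\<lambda>\<omega>. W s s \<omega>) = 0"
      using int3 by (simp add: W_def Bochner_Integration.integral_sum c power2_eq_square prob_space)
    moreover have "(\<lambda>x. (\<Sum>i<n. x i * x i) - c s s) \<in> borel_measurable (\<Pi>\<^sub>M i\<in>UNIV. borel)"
      by measurable
    moreover have "(\<lambda>x. (\<Sum>i<n. x r i * x r i) - c r r) \<in> borel_measurable (\<Pi>\<^sub>M t\<in>{r}. \<Pi>\<^sub>M i\<in>UNIV. borel)"
      by (intro borel_measurable_times borel_measurable_diff borel_measurable_sum borel_measurable_const
          measurable_component_component) auto
    ultimately show ?thesis
      using indep_vars_expectation_mult[OF serial, of s "{r}" "\<lambda>x. (\<Sum>i<n. x i * x i) - c s s"
        "\<lambda>x. (\<Sum>i<n. x r i * x r i) - c r r"] that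
      by (simp add: W_def)
  qed
  \<comment> \<open>If no period is isolated, the four periods match in pairs; the two crosswise
    matchings would make the index sets equal.\<close>
  consider "s \<notin> {t, s', t'}" | "t \<notin> {s, s', t'}" | "s' \<notin> {t', s, t}" | "t' \<notin> {s', s, t}"
    | "s = t" "s' = t'" "s \<noteq> s'"
    using ne by auto
  then show ?thesis
  proof cases
    case 1 then show ?thesis by (rule single)
  next
    case 2 then show ?thesis using single[of t s s' t'] by (simp add: W_commute)
  next
    case 3 then show ?thesis using single[of s' t' s t] by (simp add: mult.commute)
  next
    case 4 then show ?thesis using single[of t' s' s t] by (simp add: W_commute mult.commute)
  next
    case 5 then show ?thesis using diag by simp
  qed
qed

end

subsection \<open>Residual sums of squares\<close>

text \<open>Only minimal values are compared, so the identity does not depend on which minimiser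
  \<open>ols\<close> selects. The intercept becomes the coefficient of a constant regressor.\<close>

lemma sum_ols_residual_square:
  fixes x :: "nat \<Rightarrow> real ^ 'k"
  shows "(\<Sum>t<T. (ols_residual T y x t)\<^sup>2) = (\<Sum>t<T. (resid T (\<lambda>t. (1 :: real, x t)) y t)\<^sup>2)"
proof -
  let ?w = "\<lambda>t. (1 :: real, x t)"
  let ?rss = "\<lambda>(a, b). \<Sum>t<T. (y t - a - b \<bullet> x t)\<^sup>2"
  have rss: "?rss z = (\<Sum>t<T. (y t - z \<bullet> ?w t)\<^sup>2)" for z :: "real \<times> (real ^ 'k)"
    by (cases z) (simp add: algebra_simps)
  have min: "?rss (lsq T ?w y) = (\<Sum>t<T. (resid T ?w y t)\<^sup>2)"
    unfolding rss resid_def ..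
  have "?rss (lsq T ?w y) \<le> ?rss z" for z :: "real \<times> (real ^ 'k)"
    unfolding min unfolding rss by (rule resid_minimal)
  \<comment> \<open>A minimiser exists, hence the one selected in \<open>ols\<close> is
    genuine.\<close>
  then have "is_arg_min ?rss (\<lambda>_. True) (lsq T ?w y)"
    unfolding is_arg_min_def using leD by blast
  then have "is_arg_min ?rss (\<lambda>_. True) (ols T y x)"
    unfolding ols_def arg_min_def by (rule someI)
  then have "\<not> ?rss (lsq T ?w y) < ?rss (ols T y x)"
    unfolding is_arg_min_def by blast
  then have "?rss (ols T y x) \<le> (\<Sum>t<T. (resid T ?w y t)\<^sup>2)"
    unfolding min by simp
  moreover have "(\<Sum>t<T. (resid T ?w y t)\<^sup>2) \<le> ?rss (ols T y x)"
    unfolding rss by (rule resid_minimal)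
  moreover have "(\<Sum>t<T. (ols_residual T y x t)\<^sup>2) = ?rss (ols T y x)"
    by (simp add: ols_residual_def case_prod_beta)
  ultimately show ?thesis by simp
qed

text \<open>A null vector \<open>(a, b)\<close> makes \<open>b \<bullet> x t\<close> constant in
  \<open>t\<close>, so its sample variance vanishes. Positive definiteness gives
  \<open>b = 0\<close>, then \<open>a = 0\<close>.\<close>

lemma augmented_design_injective:
  fixes x :: "nat \<Rightarrow> real ^ 'k"
  assumes pd: "pos_def (sample_cov T x)" and "0 < T"
    and zero: "\<And>t. t < T \<Longrightarrow> z \<bullet> (1 :: real, x t) = 0"
  shows "z = 0"
proof -
  obtain a b where z: "z = (a, b)" by (cases z)
  have bx: "b \<bullet> x t = - a" if "t < T" for t
    using zero[OF that] by (simp add: z)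
  have "b \<bullet> (sample_cov T x *v b) = (\<Sum>k\<in>UNIV. \<Sum>l\<in>UNIV. b $ k * (sample_cov T x $ k $ l * b $ l))"
    by (simp add: inner_vec_def matrix_vector_mult_def sum_distrib_left)
  also have "\<dots> = (\<Sum>k\<in>UNIV. \<Sum>l\<in>UNIV. \<Sum>s<T. \<Sum>t<T.
      (1 / real T) * (centering T s t * ((b $ k * x s $ k) * (b $ l * x t $ l))))"
    by (simp add: sample_cov_def sum_distrib_left sum_distrib_right mult_ac)
  also have "\<dots> = (\<Sum>s<T. \<Sum>t<T. \<Sum>k\<in>UNIV. \<Sum>l\<in>UNIV.
      (1 / real T) * (centering T s t * ((b $ k * x s $ k) * (b $ l * x t $ l))))"
  proof -
    have swap: "(\<Sum>l\<in>L. \<Sum>s<T. \<Sum>t<T. F l s t) = (\<Sum>s<T. \<Sum>t<T. \<Sum>l\<in>L. F l s t)"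
      for L :: "'k set" and F :: "'k \<Rightarrow> nat \<Rightarrow> nat \<Rightarrow> real"
      by (rule trans[OF sum.swap], rule sum.cong[OF refl], rule sum.swap)
    show ?thesis unfolding swap ..
  qed
  also have "\<dots> = (\<Sum>s<T. \<Sum>t<T. (1 / real T) * (centering T s t * ((b \<bullet> x s) * (b \<bullet> x t))))"
    by (simp only: inner_vec_def inner_real_def sum_product) (simp only: sum_distrib_left)
  \<comment> \<open>Both inner products equal \<open>- a\<close>, which leaves the row sums of the
    centering matrix, all zero.\<close>
  also have "\<dots> = (\<Sum>s<T. (1 / real T) * a\<^sup>2 * (\<Sum>t<T. centering T s t))"
    by (simp add: bx sum_distrib_left sum_divide_distrib power2_eq_square mult_ac)
  also have "\<dots> = 0"
    using \<open>0 < T\<close> by (simp add: centering_def sum_subtractf)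
  finally have "b = 0"
    using pd unfolding pos_def_def by (metis less_irrefl)
  then show ?thesis
    using bx[OF \<open>0 < T\<close>] by (simp add: z zero_prod_def)
qed

context prob_space
begin

text \<open>The decomposition is \<open>R = Q + tr P * V\<close>. Independence of \<open>P\<close>
  and \<open>W\<close> gives \<open>Q\<close> mean zero, and the trace is almost surely the constant
  \<open>N\<close>, so \<open>Q\<close> is the whole deviation of \<open>R\<close> from its
  mean.\<close>

lemma sum_resid_square_moments:
  fixes u :: "nat \<Rightarrow> nat \<Rightarrow> 'a \<Rightarrow> real" and x :: "nat \<Rightarrow> 'a \<Rightarrow> 'e::euclidean_space"
  assumes serial: "indep_vars (\<lambda>_. \<Pi>\<^sub>M i\<in>UNIV. borel) (\<lambda>t \<omega> i. u i t \<omega>) UNIV"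
    and indep: "indep_of (\<Pi>\<^sub>M t\<in>UNIV. \<Pi>\<^sub>M i\<in>UNIV. borel) (\<lambda>\<omega> t i. u i t \<omega>)
      (\<Pi>\<^sub>M t\<in>UNIV. borel) (\<lambda>\<omega> t. x t \<omega>)"
    and u4: "\<And>i t. integrable M (\<lambda>\<omega>. u i t \<omega> ^ 4)"
    and mean: "\<And>i t. expectation (u i t) = 0"
    and var: "\<And>i t. expectation (\<lambda>\<omega>. (u i t \<omega>)\<^sup>2) = \<sigma>2 i"
    and trace: "AE \<omega> in M. (\<Sum>t<T. annihilator T (\<lambda>t. x t \<omega>) t t) = N"
    and bound: "\<And>s t. expectation (\<lambda>\<omega>. ((\<Sum>i<n. u i s \<omega> * u i t \<omega>) - (if s = t then \<Sum>i<n. \<sigma>2 i else 0))\<^sup>2) \<le> B"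
    and R_def: "R = (\<lambda>\<omega>. \<Sum>i<n. \<Sum>t<T. (resid T (\<lambda>t. x t \<omega>) (\<lambda>t. u i t \<omega>) t)\<^sup>2)"
  shows "integrable M R" and "expectation R = N * (\<Sum>i<n. \<sigma>2 i)"
    and "integrable M (\<lambda>\<omega>. (R \<omega> - N * (\<Sum>i<n. \<sigma>2 i))\<^sup>2)"
    and "expectation (\<lambda>\<omega>. (R \<omega> - N * (\<Sum>i<n. \<sigma>2 i))\<^sup>2) \<le> 2 * B * N"
proof -
  define V where "V = (\<Sum>i<n. \<sigma>2 i)"
  define W where "W s t \<omega> = (\<Sum>i<n. u i s \<omega> * u i t \<omega>) - (if s = t then V else 0)" for s t \<omega>
  define P where "P s t \<omega> = annihilator T (\<lambda>t. x t \<omega>) s t" for s t \<omega>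
  let ?U = "\<Pi>\<^sub>M t\<in>(UNIV :: nat set). \<Pi>\<^sub>M i\<in>(UNIV :: nat set). (borel :: real measure)"
  let ?X = "\<Pi>\<^sub>M t\<in>(UNIV :: nat set). (borel :: 'e measure)"
  have rv[measurable]: "random_variable borel (u i t)" for i t
  proof -
    have "(\<lambda>\<omega> i. u i t \<omega>) \<in> M \<rightarrow>\<^sub>M (\<Pi>\<^sub>M i\<in>UNIV. borel)"
      using serial by (auto simp: indep_vars_def)
    from measurable_compose[OF this measurable_component_singleton[of i]] show ?thesis by simp
  qed
  have x_rv: "(\<lambda>\<omega> t. x t \<omega>) \<in> M \<rightarrow>\<^sub>M ?X"
    using indep by (simp add: indep_of_def)
  note int4 = integrable_mult4[OF rv rv rv rv u4 u4 u4 u4]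
  note int3 = integrable_le_mult4[OF rv u4 rv u4 rv u4]
  have \<phi>[measurable]: "(\<lambda>y. (\<Sum>i<n. y s i * y t i) - (if s = t then V else 0)) \<in> borel_measurable ?U" for s t
    by (intro borel_measurable_times borel_measurable_diff borel_measurable_sum
          measurable_component_component borel_measurable_const UNIV_I)
  have \<psi>[measurable]: "(\<lambda>y. annihilator T y s t) \<in> borel_measurable ?X" if "s < T" "t < T" for s t
    using that by (intro measurable_annihilator measurable_component_singleton UNIV_I)
  have P_rv: "random_variable borel (P s t)" if "s < T" "t < T" for s t
    unfolding P_def by (rule measurable_compose[OF x_rv \<psi>[OF that]])
  have P_bound: "\<bar>P s t \<omega>\<bar> \<le> 1" if "s < T" "t < T" for s t \<omega>
    unfolding P_def using that by (rule abs_annihilator_le_1)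
  have P_int: "integrable M (\<lambda>\<omega>. P s t \<omega>)" if "s < T" "t < T" for s t
    using P_rv[OF that] P_bound[OF that] by (intro integrable_const_bound[where B = 1]) auto
  have W_int: "integrable M (\<lambda>\<omega>. W s t \<omega>)" for s t
    using int3 by (simp add: W_def)
  have WW_int: "integrable M (\<lambda>\<omega>. W s t \<omega> * W s' t' \<omega>)" for s t s' t'
  proof -
    let ?c = "\<lambda>s t :: nat. if s = t then V else 0"
    \<comment> \<open>Expansion into monomials of degree at most four, each integrable by the fourth
      moments.\<close>
    have "W s t \<omega> * W s' t' \<omega> = (\<Sum>i<n. \<Sum>j<n. u i s \<omega> * u i t \<omega> * u j s' \<omega> * u j t' \<omega>)
        - ?c s' t' * (\<Sum>i<n. u i s \<omega> * u i t \<omega>) - ?c s t * (\<Sum>j<n. u j s' \<omega> * u j t' \<omega>) + ?c s t * ?c s' t'" for \<omega>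
      unfolding W_def by (simp only: left_diff_distrib right_diff_distrib sum_product mult.assoc) (simp only: mult.commute)
    moreover have "integrable M (\<lambda>\<omega>. (\<Sum>i<n. \<Sum>j<n. u i s \<omega> * u i t \<omega> * u j s' \<omega> * u j t' \<omega>)
        - ?c s' t' * (\<Sum>i<n. u i s \<omega> * u i t \<omega>) - ?c s t * (\<Sum>j<n. u j s' \<omega> * u j t' \<omega>) + ?c s t * ?c s' t')"
      using int4 int3
      by (intro Bochner_Integration.integrable_add Bochner_Integration.integrable_diff
          Bochner_Integration.integrable_sum integrable_mult_right integrable_const) auto
    ultimately show ?thesis by simp
  qed
  have PP_int: "integrable M (\<lambda>\<omega>. P s t \<omega> * P s' t' \<omega>)" if "s < T" "t < T" "s' < T" "t' < T" for s t s' t'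
    using P_rv[OF that(1,2)] P_rv[OF that(3,4)] P_bound[OF that(1,2)] P_bound[OF that(3,4)]
    by (intro integrable_const_bound[where B = 1]) (auto simp: abs_mult intro!: mult_le_one)
  have W_mean: "expectation (\<lambda>\<omega>. W s t \<omega>) = 0" for s t
  proof (cases "s = t")
    case True
    then show ?thesis
      using int3 var by (simp add: W_def V_def power2_eq_square prob_space)
  next
    case False
    have "expectation (\<lambda>\<omega>. u i s \<omega> * u i t \<omega>) = 0" for i
      using indep_vars_expectation_mult[OF serial UNIV_I subset_UNIV, of s "{t}" "\<lambda>y. y i" "\<lambda>y. y t i"] False
        measurable_component_component[of t "{t}" i] measurable_component_singleton[of i UNIV "\<lambda>_. borel"] int3(1) mean
      by simp
    then show ?thesis
      using False int3 by (simp add: W_def)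
  qed
  have PW: "integrable M (\<lambda>\<omega>. P s t \<omega> * W s t \<omega>)" "expectation (\<lambda>\<omega>. P s t \<omega> * W s t \<omega>) = 0"
    if "s < T" "t < T" for s t
    using indep_of_integrable_mult[OF indep \<phi> \<psi>[OF that], of s t]
      indep_of_expectation_mult[OF indep \<phi> \<psi>[OF that], of s t] P_int[OF that] W_int[of s t] W_mean[of s t]
    by (simp_all add: P_def W_def mult.commute)
  have PPWW: "integrable M (\<lambda>\<omega>. (P s t \<omega> * P s' t' \<omega>) * (W s t \<omega> * W s' t' \<omega>))"
      "expectation (\<lambda>\<omega>. (P s t \<omega> * P s' t' \<omega>) * (W s t \<omega> * W s' t' \<omega>))
        = expectation (\<lambda>\<omega>. P s t \<omega> * P s' t' \<omega>) * expectation (\<lambda>\<omega>. W s t \<omega> * W s' t' \<omega>)"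
    if "s < T" "t < T" "s' < T" "t' < T" for s t s' t'
  proof -
    note factors = indep borel_measurable_times[OF \<phi>[of s t] \<phi>[of s' t']]
      borel_measurable_times[OF \<psi>[OF that(1,2)] \<psi>[OF that(3,4)]]
    note WW_PP = WW_int[of s t s' t', unfolded W_def] PP_int[OF that, unfolded P_def]
    have eq: "(P s t \<omega> * P s' t' \<omega>) * (W s t \<omega> * W s' t' \<omega>) = (W s t \<omega> * W s' t' \<omega>) * (P s t \<omega> * P s' t' \<omega>)" for \<omega>
      by (rule mult.commute)
    show "integrable M (\<lambda>\<omega>. (P s t \<omega> * P s' t' \<omega>) * (W s t \<omega> * W s' t' \<omega>))"
      unfolding eq unfolding P_def W_def by (rule indep_of_integrable_mult[OF factors, OF WW_PP])
    have "expectation (\<lambda>\<omega>. (W s t \<omega> * W s' t' \<omega>) * (P s t \<omega> * P s' t' \<omega>))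
        = expectation (\<lambda>\<omega>. W s t \<omega> * W s' t' \<omega>) * expectation (\<lambda>\<omega>. P s t \<omega> * P s' t' \<omega>)"
      unfolding P_def W_def by (rule indep_of_expectation_mult[OF factors, OF WW_PP])
    then show "expectation (\<lambda>\<omega>. (P s t \<omega> * P s' t' \<omega>) * (W s t \<omega> * W s' t' \<omega>))
        = expectation (\<lambda>\<omega>. P s t \<omega> * P s' t' \<omega>) * expectation (\<lambda>\<omega>. W s t \<omega> * W s' t' \<omega>)"
      unfolding eq by (simp only: mult.commute)
  qed
  have orthogonal: "expectation (\<lambda>\<omega>. W s t \<omega> * W s' t' \<omega>) = 0" if "{s, t} \<noteq> {s', t'}" for s t s' t'
    by (rule cross_product_orthogonal[OF W_def serial u4 mean _ _ that]) (simp_all add: V_def var)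
  have W_bound: "expectation (\<lambda>\<omega>. (W s t \<omega>)\<^sup>2) \<le> B" for s t
    unfolding W_def V_def by (rule bound)
  have P_commute: "P s t \<omega> = P t s \<omega>" if "s < T" "t < T" for s t \<omega>
    using that by (simp add: P_def annihilator_commute)
  have W_commute: "W s t \<omega> = W t s \<omega>" for s t \<omega>
    by (simp add: W_def mult.commute)
  define Q where "Q \<omega> = (\<Sum>s<T. \<Sum>t<T. P s t \<omega> * W s t \<omega>)" for \<omega>
  have second_moment: "integrable M (\<lambda>\<omega>. (Q \<omega>)\<^sup>2)"
    "expectation (\<lambda>\<omega>. (Q \<omega>)\<^sup>2) \<le> 2 * B * expectation (\<lambda>\<omega>. \<Sum>s<T. \<Sum>t<T. (P s t \<omega>)\<^sup>2)"
    unfolding Q_def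
    by (rule expectation_weighted_sum_square_le[where P = P and W = W and B = B];
        (rule P_rv P_bound P_commute W_commute PPWW orthogonal W_bound; assumption))+
  have R: "R \<omega> = Q \<omega> + (\<Sum>t<T. P t t \<omega>) * V" for \<omega>
  proof -
    have "R \<omega> = (\<Sum>s<T. \<Sum>t<T. \<Sum>i<n. P s t \<omega> * (u i s \<omega> * u i t \<omega>))"
      unfolding R_def sum_resid_square P_def by (rule trans[OF sum.swap], rule sum.cong[OF refl], rule sum.swap)
    also have "\<dots> = (\<Sum>s<T. \<Sum>t<T. P s t \<omega> * W s t \<omega> + P s t \<omega> * (if s = t then V else 0))"
      by (simp only: W_def sum_distrib_left[symmetric] distrib_left[symmetric] diff_add_cancel)
    also have "\<dots> = Q \<omega> + (\<Sum>t<T. P t t \<omega>) * V"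
      by (simp add: Q_def sum.distrib mult_delta_right sum_distrib_right)
    finally show ?thesis .
  qed
  have Q_int: "integrable M Q"
    unfolding Q_def[abs_def] by (intro Bochner_Integration.integrable_sum PW(1)) auto
  have "expectation Q = (\<Sum>s<T. expectation (\<lambda>\<omega>. \<Sum>t<T. P s t \<omega> * W s t \<omega>))"
    unfolding Q_def[abs_def]
    by (intro Bochner_Integration.integral_sum Bochner_Integration.integrable_sum PW(1)) auto
  also have "\<dots> = (\<Sum>s<T. \<Sum>t<T. expectation (\<lambda>\<omega>. P s t \<omega> * W s t \<omega>))"
    by (intro sum.cong refl Bochner_Integration.integral_sum PW(1)) auto
  also have "\<dots> = 0"
    using PW(2) by simp
  finally have Q_mean: "expectation Q = 0" .
  show "integrable M R"
    unfolding R[abs_def]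
    by (intro Bochner_Integration.integrable_add Q_int integrable_mult_left Bochner_Integration.integrable_sum P_int)
      auto
  have AE_R: "AE \<omega> in M. R \<omega> = Q \<omega> + N * V"
    using trace by eventually_elim (simp add: R P_def)
  have R_rv: "random_variable borel R"
    using \<open>integrable M R\<close> by auto
  have Q_rv: "random_variable borel Q"
    using Q_int by auto
  have "expectation R = expectation (\<lambda>\<omega>. Q \<omega> + N * V)"
    using R_rv Q_rv AE_R by (intro integral_cong_AE) auto
  then show "expectation R = N * (\<Sum>i<n. \<sigma>2 i)"
    using Q_int Q_mean by (simp add: V_def prob_space)
  have AE_Q: "AE \<omega> in M. (Q \<omega>)\<^sup>2 = (R \<omega> - N * (\<Sum>i<n. \<sigma>2 i))\<^sup>2"
    using AE_R by eventually_elim (simp add: V_def)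
  show "integrable M (\<lambda>\<omega>. (R \<omega> - N * (\<Sum>i<n. \<sigma>2 i))\<^sup>2)"
    using R_rv by (intro integrable_cong_AE_imp[OF second_moment(1) _ AE_Q]) auto
  have "expectation (\<lambda>\<omega>. (R \<omega> - N * (\<Sum>i<n. \<sigma>2 i))\<^sup>2) = expectation (\<lambda>\<omega>. (Q \<omega>)\<^sup>2)"
    using R_rv Q_rv AE_Q by (intro integral_cong_AE) auto
  also have "\<dots> \<le> 2 * B * expectation (\<lambda>\<omega>. \<Sum>s<T. \<Sum>t<T. (P s t \<omega>)\<^sup>2)"
    by (rule second_moment(2))
  \<comment> \<open>The squared Frobenius norm of the projection is its trace.\<close>
  also have "expectation (\<lambda>\<omega>. \<Sum>s<T. \<Sum>t<T. (P s t \<omega>)\<^sup>2) = expectation (\<lambda>\<omega>. N)"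
  proof (rule integral_cong_AE)
    show "AE \<omega> in M. (\<Sum>s<T. \<Sum>t<T. (P s t \<omega>)\<^sup>2) = N"
      using trace by eventually_elim (simp add: P_def sum_annihilator_square)
  qed (use P_rv in auto)
  finally show "expectation (\<lambda>\<omega>. (R \<omega> - N * (\<Sum>i<n. \<sigma>2 i))\<^sup>2) \<le> 2 * B * N"
    by (simp add: prob_space)
qed

end

subsection \<open>Moments of the errors\<close>

lemma power2_add3_le: "((a :: real) + b + c)\<^sup>2 \<le> 3 * a\<^sup>2 + 3 * b\<^sup>2 + 3 * c\<^sup>2"
proof -
  have "0 \<le> (a - b)\<^sup>2 + (b - c)\<^sup>2 + (a - c)\<^sup>2" by simp
  then show ?thesis by (simp add: power2_eq_square algebra_simps)
qed

lemma power4_add_le: "((a :: real) + b) ^ 4 \<le> 8 * a ^ 4 + 8 * b ^ 4"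
proof -
  have sq: "(x + y)\<^sup>2 \<le> 2 * x\<^sup>2 + 2 * y\<^sup>2" for x y :: real
    using sum_squares_bound[of x y] by (simp add: power2_sum)
  have "(a + b) ^ 4 = ((a + b)\<^sup>2)\<^sup>2" by (simp add: power_mult[symmetric])
  also have "\<dots> \<le> (2 * a\<^sup>2 + 2 * b\<^sup>2)\<^sup>2"
    using sq by (intro power_mono) auto
  also have "\<dots> \<le> 8 * a ^ 4 + 8 * b ^ 4"
    using sq[of "2 * a\<^sup>2" "2 * b\<^sup>2"] by (simp add: power_mult_distrib power_mult[symmetric])
  finally show ?thesis .
qed

section \<open>Bounds from row-summable covariances and weak loadings\<close>

text \<open>Used for the variance of the loading-weighted sum of idiosyncratic errors: bounded row
  sums make the quadratic form linear in \<open>n\<close>.\<close>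

lemma sum_sum_bounded_matrix_le:
  fixes c :: "nat \<Rightarrow> real"
  assumes rows: "\<And>i. i < n \<Longrightarrow> (\<Sum>j<n. \<bar>\<sigma> i j\<bar>) \<le> C" and c: "\<And>i. \<bar>c i\<bar> \<le> D"
  shows "(\<Sum>i<n. \<Sum>j<n. c i * c j * \<sigma> i j) \<le> D\<^sup>2 * C * real n"
proof -
  have "c i * c j * \<sigma> i j \<le> D\<^sup>2 * \<bar>\<sigma> i j\<bar>" for i j
  proof -
    have "c i * c j * \<sigma> i j \<le> \<bar>c i\<bar> * \<bar>c j\<bar> * \<bar>\<sigma> i j\<bar>"
      by (metis abs_ge_self abs_mult)
    also have "\<dots> \<le> D * D * \<bar>\<sigma> i j\<bar>"
      using c[of i] c[of j] by (intro mult_right_mono mult_mono) auto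
    finally show ?thesis by (simp add: power2_eq_square)
  qed
  then have "(\<Sum>i<n. \<Sum>j<n. c i * c j * \<sigma> i j) \<le> (\<Sum>i<n. \<Sum>j<n. D\<^sup>2 * \<bar>\<sigma> i j\<bar>)"
    by (intro sum_mono)
  also have "\<dots> = (\<Sum>i<n. D\<^sup>2 * (\<Sum>j<n. \<bar>\<sigma> i j\<bar>))"
    by (simp add: sum_distrib_left)
  also have "\<dots> \<le> (\<Sum>i<n. D\<^sup>2 * C)"
    using rows by (intro sum_mono mult_left_mono) auto
  finally show ?thesis by (simp add: mult_ac)
qed

text \<open>Every entry is bounded by its absolute row sum, so one factor of each square can be
  replaced by \<open>C\<close>.\<close>

lemma sum_sum_square_le:
  assumes rows: "\<And>i. i < n \<Longrightarrow> (\<Sum>j<n. \<bar>\<sigma> i j\<bar>) \<le> (C :: real)"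
  shows "(\<Sum>i<n. \<Sum>j<n. (\<sigma> i j)\<^sup>2) \<le> C\<^sup>2 * real n"
proof -
  have "(\<Sum>j<n. (\<sigma> i j)\<^sup>2) \<le> C\<^sup>2" if "i < n" for i
  proof -
    have "(\<Sum>j<n. (\<sigma> i j)\<^sup>2) = (\<Sum>j<n. \<bar>\<sigma> i j\<bar> * \<bar>\<sigma> i j\<bar>)"
      by (simp add: power2_eq_square)
    also have "\<dots> \<le> (\<Sum>j<n. C * \<bar>\<sigma> i j\<bar>)"
    proof (intro sum_mono mult_right_mono)
      fix j assume "j \<in> {..<n}"
      then have "\<bar>\<sigma> i j\<bar> \<le> (\<Sum>j<n. \<bar>\<sigma> i j\<bar>)" by (intro member_le_sum) auto
      with rows[OF that] show "\<bar>\<sigma> i j\<bar> \<le> C" by simp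
    qed simp
    also have "\<dots> = C * (\<Sum>j<n. \<bar>\<sigma> i j\<bar>)" by (simp add: sum_distrib_left)
    also have "\<dots> \<le> C * C"
      using rows[OF that] order_trans[OF sum_nonneg rows[OF that]] by (intro mult_left_mono) auto
    finally show ?thesis by (simp add: power2_eq_square)
  qed
  then have "(\<Sum>i<n. \<Sum>j<n. (\<sigma> i j)\<^sup>2) \<le> (\<Sum>i<n. C\<^sup>2)"
    by (intro sum_mono) auto
  then show ?thesis by (simp add: mult.commute)
qed

text \<open>This is where \<open>\<alpha> < 1 / 2\<close> enters. Bounded loadings give a sum of
  squares of order at most \<open>n powr \<alpha>\<close>, whose square has exponent below
  1.\<close>

lemma weak_loadings_sum_square:
  fixes \<gamma> :: "nat \<Rightarrow> real"
  assumes bound: "\<And>i. \<bar>\<gamma> i\<bar> \<le> C" and O: "(\<lambda>n. \<Sum>i<n. \<bar>\<gamma> i\<bar>) \<in> O(\<lambda>n. real n powr \<alpha>)" and "\<alpha> < 1 / 2"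
  obtains D where "0 \<le> D" "\<forall>\<^sub>F n in sequentially. (\<Sum>i<n. (\<gamma> i)\<^sup>2)\<^sup>2 \<le> D * real n"
proof -
  obtain K where K: "\<forall>\<^sub>F n in sequentially. norm (\<Sum>i<n. \<bar>\<gamma> i\<bar>) \<le> K * norm (real n powr \<alpha>)"
    using O by (elim landau_o.bigE)
  have "\<forall>\<^sub>F n in sequentially. (\<Sum>i<n. (\<gamma> i)\<^sup>2)\<^sup>2 \<le> (C * K)\<^sup>2 * real n"
    using K eventually_ge_at_top[of 1]
  proof eventually_elim
    case (elim n)
    have "0 \<le> C" using bound[of 0] by linarith
    have "(\<Sum>i<n. (\<gamma> i)\<^sup>2) = (\<Sum>i<n. \<bar>\<gamma> i\<bar> * \<bar>\<gamma> i\<bar>)"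
      by (simp add: power2_eq_square)
    also have "\<dots> \<le> (\<Sum>i<n. C * \<bar>\<gamma> i\<bar>)"
      using bound by (intro sum_mono mult_right_mono) auto
    also have "\<dots> = C * (\<Sum>i<n. \<bar>\<gamma> i\<bar>)"
      by (simp add: sum_distrib_left)
    also have "\<dots> \<le> C * (K * real n powr \<alpha>)"
      using elim \<open>0 \<le> C\<close> by (intro mult_left_mono) auto
    finally have "(\<Sum>i<n. (\<gamma> i)\<^sup>2)\<^sup>2 \<le> (C * K * real n powr \<alpha>)\<^sup>2"
      by (intro power_mono) (auto simp: sum_nonneg mult.assoc)
    also have "\<dots> = (C * K)\<^sup>2 * real n powr (\<alpha> + \<alpha>)"
      unfolding powr_add power2_eq_square by (simp only: mult_ac)
    also have "\<dots> \<le> (C * K)\<^sup>2 * real n powr 1"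
      using elim \<open>\<alpha> < 1 / 2\<close> by (intro mult_left_mono powr_mono) auto
    finally show ?case using elim by simp
  qed
  then show thesis by (rule that[rotated]) simp
qed

context prob_space
begin

text \<open>The errors are a function of the pair of idiosyncratic and latent processes. The pair is
  independent of the observed factors by \<open>indep_of_Pair\<close> and serially independent by
  \<open>indep_vars_Pair\<close>; both properties pass to \<open>u\<close>.\<close>

lemma error_process:
  assumes lf: "latent_factor f g \<gamma> \<alpha>" and ie: "idiosyncratic_errors f g \<beta> v \<sigma>\<^sub>v"
    and u_def: "\<And>i t \<omega>. u i t \<omega> = \<gamma> i * g t \<omega> + v i t \<omega>"
  shows error_serially_indep: "indep_vars (\<lambda>_. \<Pi>\<^sub>M i\<in>UNIV. borel) (\<lambda>t \<omega> i. u i t \<omega>) UNIV"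
    and error_indep_of_factors: "indep_of (\<Pi>\<^sub>M t\<in>UNIV. \<Pi>\<^sub>M i\<in>UNIV. borel) (\<lambda>\<omega> t i. u i t \<omega>)
      (\<Pi>\<^sub>M t\<in>UNIV. borel) (\<lambda>\<omega> t. f t \<omega>)"
    and latent_indep_of_idiosyncratic: "indep_of (\<Pi>\<^sub>M t\<in>UNIV. \<Pi>\<^sub>M i\<in>UNIV. borel) (\<lambda>\<omega> t i. v i t \<omega>)
      (\<Pi>\<^sub>M t\<in>UNIV. borel) (\<lambda>\<omega> t. g t \<omega>)"
    and error_integrable_power4: "integrable M (\<lambda>\<omega>. u i t \<omega> ^ 4)"
    and error_mean: "expectation (u i t) = 0"
    and error_covariance: "expectation (\<lambda>\<omega>. u i t \<omega> * u j t \<omega>) = \<gamma> i * \<gamma> j + \<sigma>\<^sub>v i j"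
proof -
  let ?V = "\<Pi>\<^sub>M t\<in>(UNIV :: nat set). \<Pi>\<^sub>M i\<in>(UNIV :: nat set). (borel :: real measure)"
  let ?G = "\<Pi>\<^sub>M t\<in>(UNIV :: nat set). (borel :: real measure)"
  have GF: "indep_of ?G (\<lambda>\<omega> t. g t \<omega>) (\<Pi>\<^sub>M t\<in>UNIV. borel) (\<lambda>\<omega> t. f t \<omega>)"
    and g_serial: "indep_vars (\<lambda>_. borel) g UNIV"
    and g_mean: "\<And>t. expectation (g t) = 0" "\<And>t. expectation (\<lambda>\<omega>. (g t \<omega>)\<^sup>2) = 1"
    and g4: "\<And>t. integrable M (\<lambda>\<omega>. g t \<omega> ^ 4)"
    using lf by (auto simp: latent_factor_def)
  have V_FGB: "indep_of ?V (\<lambda>\<omega> t i. v i t \<omega>)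
      ((\<Pi>\<^sub>M t\<in>UNIV. borel) \<Otimes>\<^sub>M ?G \<Otimes>\<^sub>M (\<Pi>\<^sub>M i\<in>UNIV. borel)) (\<lambda>\<omega>. (\<lambda>t. f t \<omega>, \<lambda>t. g t \<omega>, \<lambda>i. \<beta> i \<omega>))"
    and v_serial: "indep_vars (\<lambda>_. \<Pi>\<^sub>M i\<in>UNIV. borel) (\<lambda>t \<omega> i. v i t \<omega>) UNIV"
    and v_mean: "\<And>i t. expectation (v i t) = 0"
    and v4: "\<And>i t. integrable M (\<lambda>\<omega>. v i t \<omega> ^ 4)"
    and v_cov: "\<And>i j t. expectation (\<lambda>\<omega>. v i t \<omega> * v j t \<omega>) = \<sigma>\<^sub>v i j"
    using ie by (auto simp: idiosyncratic_errors_def)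
  have g_rv[measurable]: "random_variable borel (g t)" for t
    using g_serial by (simp add: indep_vars_def)
  have v_rv[measurable]: "random_variable borel (v i t)" for i t
    using V_FGB measurable_compose[OF _ measurable_component_component[of t UNIV i]]
    by (auto simp: indep_of_def)
  have u_eq: "u i t = (\<lambda>\<omega>. \<gamma> i * g t \<omega> + v i t \<omega>)" for i t
    by (simp add: fun_eq_iff u_def)
  show VG: "indep_of ?V (\<lambda>\<omega> t i. v i t \<omega>) ?G (\<lambda>\<omega> t. g t \<omega>)"
    using indep_of_compose[OF V_FGB measurable_ident measurable_compose[OF measurable_snd measurable_fst]]
    by simp
  \<comment> \<open>The loadings are dropped and the components reordered so that \<open>g\<close>
    can be joined to \<open>v\<close>.\<close>
  have "indep_of ?V (\<lambda>\<omega> t i. v i t \<omega>) (?G \<Otimes>\<^sub>M (\<Pi>\<^sub>M t\<in>UNIV. borel)) (\<lambda>\<omega>. (\<lambda>t. g t \<omega>, \<lambda>t. f t \<omega>))"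
    using indep_of_compose[OF V_FGB measurable_ident
        measurable_Pair[OF measurable_compose[OF measurable_snd measurable_fst] measurable_fst]]
    by simp
  note VG_F = indep_of_Pair[OF this GF]
  have "(\<lambda>(y, z) t i. \<gamma> i * z t + y t i) \<in> ?V \<Otimes>\<^sub>M ?G \<rightarrow>\<^sub>M ?V"
    unfolding case_prod_beta
    by (intro measurable_abs_UNIV borel_measurable_add borel_measurable_times borel_measurable_const
        measurable_compose[OF measurable_fst measurable_component_component]
        measurable_compose[OF measurable_snd measurable_component_singleton] UNIV_I)
  from indep_of_compose[OF VG_F this measurable_ident]
  show "indep_of ?V (\<lambda>\<omega> t i. u i t \<omega>) (\<Pi>\<^sub>M t\<in>UNIV. borel) (\<lambda>\<omega> t. f t \<omega>)"
    by (simp add: u_def)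
  have "(\<lambda>(y, z) i. \<gamma> i * z + y i) \<in> (\<Pi>\<^sub>M i\<in>UNIV. borel) \<Otimes>\<^sub>M borel \<rightarrow>\<^sub>M (\<Pi>\<^sub>M i\<in>(UNIV :: nat set). borel)"
    unfolding case_prod_beta
    by (intro measurable_abs_UNIV borel_measurable_add borel_measurable_times borel_measurable_const
        measurable_compose[OF measurable_fst measurable_component_singleton] measurable_snd UNIV_I)
  from indep_vars_compose2[OF indep_vars_Pair[OF v_serial g_serial VG] this]
  show "indep_vars (\<lambda>_. \<Pi>\<^sub>M i\<in>UNIV. borel) (\<lambda>t \<omega> i. u i t \<omega>) UNIV"
    by (simp add: u_def)
  show "integrable M (\<lambda>\<omega>. u i t \<omega> ^ 4)" for i t
  proof (rule Bochner_Integration.integrable_bound)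
    show "integrable M (\<lambda>\<omega>. 8 * (\<gamma> i ^ 4 * g t \<omega> ^ 4) + 8 * v i t \<omega> ^ 4)"
      using g4 v4 by auto
    have "u i t \<omega> ^ 4 \<le> 8 * (\<gamma> i ^ 4 * g t \<omega> ^ 4) + 8 * v i t \<omega> ^ 4" for \<omega>
      using power4_add_le[of "\<gamma> i * g t \<omega>" "v i t \<omega>"] by (simp add: u_def power_mult_distrib)
    then show "AE \<omega> in M. norm (u i t \<omega> ^ 4) \<le> norm (8 * (\<gamma> i ^ 4 * g t \<omega> ^ 4) + 8 * v i t \<omega> ^ 4)"
      by simp
  qed (simp add: u_eq)
  note g3 = integrable_le_mult4[OF g_rv g4 g_rv g4 g_rv g4]
  note v3 = integrable_le_mult4[OF v_rv v4 v_rv v4 v_rv v4]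
  note gv = integrable_le_mult4[OF g_rv g4 v_rv v4 v_rv v4]
  show "expectation (u i t) = 0" for i t
    using g3(1) v3(1) g_mean v_mean by (simp add: u_eq)
  have gv_mean: "expectation (\<lambda>\<omega>. g t \<omega> * v i t \<omega>) = 0" for i t
    using indep_of_expectation_mult[OF VG measurable_component_component[of t UNIV i]
        measurable_component_singleton[of t UNIV "\<lambda>_. borel"]] v3(1) g3(1) v_mean
    by (simp add: mult.commute)
  have "u i t \<omega> * u j t \<omega> = \<gamma> i * \<gamma> j * (g t \<omega>)\<^sup>2 + \<gamma> i * (g t \<omega> * v j t \<omega>) + \<gamma> j * (g t \<omega> * v i t \<omega>)
      + v i t \<omega> * v j t \<omega>" for \<omega>
    by (simp add: u_def power2_eq_square algebra_simps)
  then show "expectation (\<lambda>\<omega>. u i t \<omega> * u j t \<omega>) = \<gamma> i * \<gamma> j + \<sigma>\<^sub>v i j"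
    using g3 v3 gv gv_mean g_mean v_cov by (simp add: power2_eq_square)
qed

text \<open>The constant is uniform in \<open>n\<close> and in both periods. The latent factor
  accounts for the squared sum of squared loadings, the weak cross-sectional dependence of
  \<open>v\<close> for the term linear in \<open>n\<close>.\<close>

lemma error_cross_product_second_moment:
  assumes lf: "latent_factor f g \<gamma> \<alpha>" and ie: "idiosyncratic_errors f g \<beta> v \<sigma>\<^sub>v"
    and u_def: "\<And>i t \<omega>. u i t \<omega> = \<gamma> i * g t \<omega> + v i t \<omega>"
  obtains A where "0 \<le> A"
    "\<And>n s t. expectation (\<lambda>\<omega>. ((\<Sum>i<n. u i s \<omega> * u i t \<omega>) - (if s = t then \<Sum>i<n. (\<gamma> i)\<^sup>2 + \<sigma>\<^sub>v i i else 0))\<^sup>2)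
      \<le> A * ((\<Sum>i<n. (\<gamma> i)\<^sup>2)\<^sup>2 + real n)"
proof -
  note error = error_process[OF lf ie u_def]
  have g_serial: "indep_vars (\<lambda>_. borel) g UNIV"
    and g_mean: "\<And>t. expectation (g t) = 0" "\<And>t. expectation (\<lambda>\<omega>. (g t \<omega>)\<^sup>2) = 1"
    and g4: "\<And>t. integrable M (\<lambda>\<omega>. g t \<omega> ^ 4)"
    using lf by (auto simp: latent_factor_def)
  obtain C2 where C2: "\<And>t. expectation (\<lambda>\<omega>. g t \<omega> ^ 4) < C2"
    using lf by (auto simp: latent_factor_def)
  obtain C3 where C3: "\<And>i. \<bar>\<gamma> i\<bar> < C3"
    using lf by (auto simp: latent_factor_def)
  have v4: "\<And>i t. integrable M (\<lambda>\<omega>. v i t \<omega> ^ 4)"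
    and v_cov: "\<And>i j t. expectation (\<lambda>\<omega>. v i t \<omega> * v j t \<omega>) = \<sigma>\<^sub>v i j"
    using ie by (auto simp: idiosyncratic_errors_def)
  obtain C1 where C1: "\<And>n i. i < n \<Longrightarrow> (\<Sum>j<n. \<bar>\<sigma>\<^sub>v i j\<bar>) \<le> C1"
    using ie by (auto simp: idiosyncratic_errors_def)
  obtain C4 where C4: "\<And>t n i. i < n \<Longrightarrow> (\<Sum>j<n. covariance (\<lambda>\<omega>. (v i t \<omega>)\<^sup>2) (\<lambda>\<omega>. (v j t \<omega>)\<^sup>2)) \<le> C4"
  proof -
    have "\<exists>C. \<forall>t n. \<forall>i<n. (\<Sum>j<n. covariance (\<lambda>\<omega>. (v i t \<omega>)\<^sup>2) (\<lambda>\<omega>. (v j t \<omega>)\<^sup>2)) \<le> C"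
      using ie by (simp add: idiosyncratic_errors_def)
    then show thesis using that by metis
  qed
  have "0 \<le> C1" using C1[of 0 1] by simp
  have "0 \<le> expectation (\<lambda>\<omega>. g 0 \<omega> ^ 4)"
    by (rule Bochner_Integration.integral_nonneg) simp
  with C2[of 0] have "0 \<le> C2" by linarith
  have g_rv[measurable]: "random_variable borel (g t)" for t
    using g_serial by (simp add: indep_vars_def)
  have v_rv[measurable]: "random_variable borel (v i t)" for i t
    using ie measurable_compose[OF _ measurable_component_component[of t UNIV i]]
    by (auto simp: idiosyncratic_errors_def indep_of_def)
  have u_rv[measurable]: "random_variable borel (u i t)" for i t
  proof -
    have "u i t = (\<lambda>\<omega>. \<gamma> i * g t \<omega> + v i t \<omega>)"
      by (simp add: fun_eq_iff u_def)
    then show ?thesis by simp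
  qed
  note g_int4 = integrable_mult4[OF g_rv g_rv g_rv g_rv g4 g4 g4 g4]
  note g_int3 = integrable_le_mult4[OF g_rv g4 g_rv g4 g_rv g4]
  note v_int4 = integrable_mult4[OF v_rv v_rv v_rv v_rv v4 v4 v4 v4]
  note v_int3 = integrable_le_mult4[OF v_rv v4 v_rv v4 v_rv v4]
  note u_int4 = integrable_mult4[OF u_rv u_rv u_rv u_rv error(4) error(4) error(4) error(4)]
  note u_int3 = integrable_le_mult4[OF u_rv error(4) u_rv error(4) u_rv error(4)]
  define \<Gamma> where "\<Gamma> n = (\<Sum>i<n. (\<gamma> i)\<^sup>2)" for n
  \<comment> \<open>The sum of the coefficients from the off-diagonal case, \<open>2\<close> and
    \<open>2 * C1^2\<close>, and the diagonal case, \<open>3 * C2\<close> and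
    \<open>12 * C3^2 * C1 + 3 * \<bar>C4\<bar>\<close>. The absolute value secures
    nonnegativity.\<close>
  define A where "A = 2 + 2 * C1\<^sup>2 + 3 * C2 + 12 * (C3\<^sup>2 * C1) + 3 * \<bar>C4\<bar>"
  have A: "0 \<le> A" "a * x + b * y \<le> A * (x + y)"
    if "0 \<le> x" "0 \<le> y" "a \<le> 2 \<or> a \<le> 3 * C2" "b \<le> 2 * C1\<^sup>2 \<or> b \<le> 12 * (C3\<^sup>2 * C1) + 3 * \<bar>C4\<bar>"
    for a b x y
  proof -
    have nonneg: "0 \<le> C1\<^sup>2" "0 \<le> C3\<^sup>2 * C1" using \<open>0 \<le> C1\<close> by auto
    then have "a \<le> A" "b \<le> A" using that(3,4) \<open>0 \<le> C2\<close> unfolding A_def by linarith+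
    then show "a * x + b * y \<le> A * (x + y)"
      using that(1,2) by (simp add: distrib_left add_mono mult_right_mono)
    show "0 \<le> A" using nonneg \<open>0 \<le> C2\<close> unfolding A_def by linarith
  qed
  have off_diag: "expectation (\<lambda>\<omega>. (\<Sum>i<n. u i s \<omega> * u i t \<omega>)\<^sup>2) \<le> A * ((\<Gamma> n)\<^sup>2 + real n)"
    if "s \<noteq> t" for n s t
  proof -
    \<comment> \<open>Independence of the two periods yields a product of two equal cross-sectional
      covariances.\<close>
    have pair: "expectation (\<lambda>\<omega>. (u i s \<omega> * u j s \<omega>) * (u i t \<omega> * u j t \<omega>)) = (\<gamma> i * \<gamma> j + \<sigma>\<^sub>v i j)\<^sup>2" for i j
    proof -
      have "(\<lambda>y. y i * y j) \<in> borel_measurable (\<Pi>\<^sub>M i\<in>(UNIV :: nat set). (borel :: real measure))"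
        by measurable
      moreover have "(\<lambda>y. y t i * y t j) \<in> borel_measurable (\<Pi>\<^sub>M t\<in>{t}. \<Pi>\<^sub>M i\<in>(UNIV :: nat set). (borel :: real measure))"
        by (intro borel_measurable_times measurable_component_component) auto
      ultimately show ?thesis
        using indep_vars_expectation_mult[OF error(1) UNIV_I subset_UNIV, of s "{t}" "\<lambda>y. y i * y j" "\<lambda>y. y t i * y t j"]
          that u_int3(2) error(6) by (simp add: power2_eq_square)
    qed
    have int: "integrable M (\<lambda>\<omega>. (u i s \<omega> * u j s \<omega>) * (u i t \<omega> * u j t \<omega>))" for i j
      using u_int4 by (simp add: mult.assoc[symmetric])
    have "(\<lambda>\<omega>. (\<Sum>i<n. u i s \<omega> * u i t \<omega>)\<^sup>2)
        = (\<lambda>\<omega>. \<Sum>i<n. \<Sum>j<n. (u i s \<omega> * u j s \<omega>) * (u i t \<omega> * u j t \<omega>))"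
      by (simp add: power2_eq_square sum_product mult_ac)
    then have "expectation (\<lambda>\<omega>. (\<Sum>i<n. u i s \<omega> * u i t \<omega>)\<^sup>2) = (\<Sum>i<n. \<Sum>j<n. (\<gamma> i * \<gamma> j + \<sigma>\<^sub>v i j)\<^sup>2)"
      using int pair by (simp add: Bochner_Integration.integral_sum)
    also have "\<dots> \<le> (\<Sum>i<n. \<Sum>j<n. 2 * ((\<gamma> i)\<^sup>2 * (\<gamma> j)\<^sup>2) + 2 * (\<sigma>\<^sub>v i j)\<^sup>2)"
    proof (intro sum_mono)
      show "(\<gamma> i * \<gamma> j + \<sigma>\<^sub>v i j)\<^sup>2 \<le> 2 * ((\<gamma> i)\<^sup>2 * (\<gamma> j)\<^sup>2) + 2 * (\<sigma>\<^sub>v i j)\<^sup>2" for i j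
        using sum_squares_bound[of "\<gamma> i * \<gamma> j" "\<sigma>\<^sub>v i j"] by (simp add: power2_sum power_mult_distrib)
    qed
    also have "\<dots> = 2 * (\<Gamma> n)\<^sup>2 + 2 * (\<Sum>i<n. \<Sum>j<n. (\<sigma>\<^sub>v i j)\<^sup>2)"
      by (simp add: sum.distrib sum_distrib_left[symmetric] \<Gamma>_def power2_eq_square[of "sum _ _"] sum_product)
    also have "\<dots> \<le> 2 * (\<Gamma> n)\<^sup>2 + 2 * (C1\<^sup>2 * real n)"
      using sum_sum_square_le[OF C1] by (intro add_mono mult_left_mono) auto
    also have "\<dots> \<le> A * ((\<Gamma> n)\<^sup>2 + real n)"
      using A(2)[of "(\<Gamma> n)\<^sup>2" "real n" 2 "2 * C1\<^sup>2"] by simp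
    finally show ?thesis .
  qed
  have diag: "expectation (\<lambda>\<omega>. ((\<Sum>i<n. u i t \<omega> * u i t \<omega>) - (\<Sum>i<n. (\<gamma> i)\<^sup>2 + \<sigma>\<^sub>v i i))\<^sup>2) \<le> A * ((\<Gamma> n)\<^sup>2 + real n)"
    for n t
  proof -
    \<comment> \<open>The centred sum will be split as
      \<open>\<Gamma> n * (g^2 - 1) + 2 * h * g + w\<close>: a latent, a mixed and an idiosyncratic
      part.\<close>
    define h where "h \<omega> = (\<Sum>i<n. \<gamma> i * v i t \<omega>)" for \<omega>
    define w where "w \<omega> = (\<Sum>i<n. (v i t \<omega>)\<^sup>2 - \<sigma>\<^sub>v i i)" for \<omega>
    have g2: "integrable M (\<lambda>\<omega>. (g t \<omega>)\<^sup>2)"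
      using g_int3(2)[of t t] by (simp add: power2_eq_square)
    \<comment> \<open>As \<open>g\<close> has unit second moment, the expectation is the fourth
      moment minus 1.\<close>
    have g_part: "integrable M (\<lambda>\<omega>. ((g t \<omega>)\<^sup>2 - 1)\<^sup>2)" "expectation (\<lambda>\<omega>. ((g t \<omega>)\<^sup>2 - 1)\<^sup>2) \<le> C2"
    proof -
      have eq: "((g t \<omega>)\<^sup>2 - 1)\<^sup>2 = g t \<omega> ^ 4 - 2 * (g t \<omega>)\<^sup>2 + 1" for \<omega>
        by (simp add: power2_diff power_mult[symmetric])
      show "integrable M (\<lambda>\<omega>. ((g t \<omega>)\<^sup>2 - 1)\<^sup>2)"
        unfolding eq using g4 g2 by auto
      show "expectation (\<lambda>\<omega>. ((g t \<omega>)\<^sup>2 - 1)\<^sup>2) \<le> C2"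
        unfolding eq using g4 g2 g_mean C2[of t] by (simp add: prob_space)
    qed
    have h2_eq: "(h \<omega>)\<^sup>2 = (\<Sum>i<n. \<Sum>j<n. \<gamma> i * \<gamma> j * (v i t \<omega> * v j t \<omega>))" for \<omega>
      by (simp add: h_def power2_eq_square sum_product mult_ac)
    have h2: "integrable M (\<lambda>\<omega>. (h \<omega>)\<^sup>2)"
      unfolding h2_eq by (intro Bochner_Integration.integrable_sum integrable_mult_right v_int3(2))
    have h2_mean: "expectation (\<lambda>\<omega>. (h \<omega>)\<^sup>2) \<le> C3\<^sup>2 * C1 * real n"
    proof -
      have "expectation (\<lambda>\<omega>. (h \<omega>)\<^sup>2) = (\<Sum>i<n. \<Sum>j<n. \<gamma> i * \<gamma> j * \<sigma>\<^sub>v i j)"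
        unfolding h2_eq using v_int3(2) v_cov by (simp add: Bochner_Integration.integral_sum)
      also have "\<dots> \<le> C3\<^sup>2 * C1 * real n"
        using C1 C3 by (intro sum_sum_bounded_matrix_le) (auto intro: less_imp_le)
      finally show ?thesis .
    qed
    \<comment> \<open>\<open>h\<close> depends on the idiosyncratic errors only, hence is
      independent of \<open>g\<close>, whose second moment is 1.\<close>
    have gh: "integrable M (\<lambda>\<omega>. (h \<omega>)\<^sup>2 * (g t \<omega>)\<^sup>2)"
      "expectation (\<lambda>\<omega>. (h \<omega>)\<^sup>2 * (g t \<omega>)\<^sup>2) = expectation (\<lambda>\<omega>. (h \<omega>)\<^sup>2)"
    proof -
      have meas: "(\<lambda>y. (\<Sum>i<n. \<gamma> i * y t i)\<^sup>2) \<in> borel_measurable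
          (\<Pi>\<^sub>M t\<in>(UNIV :: nat set). \<Pi>\<^sub>M i\<in>(UNIV :: nat set). (borel :: real measure))"
        by (intro borel_measurable_power borel_measurable_sum borel_measurable_times borel_measurable_const
            measurable_component_component UNIV_I)
      have meas': "(\<lambda>y. (y t)\<^sup>2) \<in> borel_measurable (\<Pi>\<^sub>M t\<in>(UNIV :: nat set). (borel :: real measure))"
        by measurable
      show "integrable M (\<lambda>\<omega>. (h \<omega>)\<^sup>2 * (g t \<omega>)\<^sup>2)"
        "expectation (\<lambda>\<omega>. (h \<omega>)\<^sup>2 * (g t \<omega>)\<^sup>2) = expectation (\<lambda>\<omega>. (h \<omega>)\<^sup>2)"
        using indep_of_integrable_mult[OF error(3) meas meas'] indep_of_expectation_mult[OF error(3) meas meas'] h2 g2 g_mean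
        by (simp_all add: h_def)
    qed
    have w2_eq: "(w \<omega>)\<^sup>2 = (\<Sum>i<n. \<Sum>j<n. ((v i t \<omega>)\<^sup>2 - \<sigma>\<^sub>v i i) * ((v j t \<omega>)\<^sup>2 - \<sigma>\<^sub>v j j))" for \<omega>
      by (simp add: w_def power2_eq_square[of "sum _ _"] sum_product)
    have vv: "integrable M (\<lambda>\<omega>. ((v i t \<omega>)\<^sup>2 - \<sigma>\<^sub>v i i) * ((v j t \<omega>)\<^sup>2 - \<sigma>\<^sub>v j j))" for i j
    proof -
      have eq: "((v i t \<omega>)\<^sup>2 - \<sigma>\<^sub>v i i) * ((v j t \<omega>)\<^sup>2 - \<sigma>\<^sub>v j j) = v i t \<omega> * v i t \<omega> * v j t \<omega> * v j t \<omega>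
          - \<sigma>\<^sub>v j j * (v i t \<omega> * v i t \<omega>) - \<sigma>\<^sub>v i i * (v j t \<omega> * v j t \<omega>) + \<sigma>\<^sub>v i i * \<sigma>\<^sub>v j j" for \<omega>
        by (simp add: power2_eq_square algebra_simps)
      show ?thesis unfolding eq
        by (intro Bochner_Integration.integrable_add Bochner_Integration.integrable_diff integrable_mult_right
            integrable_const v_int3(2) v_int4)
    qed
    have w2: "integrable M (\<lambda>\<omega>. (w \<omega>)\<^sup>2)"
      unfolding w2_eq by (intro Bochner_Integration.integrable_sum vv)
    have w2_mean: "expectation (\<lambda>\<omega>. (w \<omega>)\<^sup>2) \<le> \<bar>C4\<bar> * real n"
    proof -
      have "expectation (\<lambda>\<omega>. (v i t \<omega>)\<^sup>2) = \<sigma>\<^sub>v i i" for i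
        using v_cov[of i t i] by (simp add: power2_eq_square)
      then have "expectation (\<lambda>\<omega>. (w \<omega>)\<^sup>2) = (\<Sum>i<n. \<Sum>j<n. covariance (\<lambda>\<omega>. (v i t \<omega>)\<^sup>2) (\<lambda>\<omega>. (v j t \<omega>)\<^sup>2))"
        unfolding w2_eq covariance_def using vv by (simp add: Bochner_Integration.integral_sum)
      also have "\<dots> \<le> (\<Sum>i<n. \<bar>C4\<bar>)"
        using C4 by (intro sum_mono) (meson abs_ge_self lessThan_iff order_trans)
      finally show ?thesis by (simp add: mult.commute)
    qed
    have "(\<Sum>i<n. u i t \<omega> * u i t \<omega>) - (\<Sum>i<n. (\<gamma> i)\<^sup>2 + \<sigma>\<^sub>v i i) = \<Gamma> n * ((g t \<omega>)\<^sup>2 - 1) + 2 * (h \<omega> * g t \<omega>) + w \<omega>" for \<omega>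
      unfolding u_def \<Gamma>_def h_def w_def sum_distrib_left sum_distrib_right sum.distrib[symmetric] sum_subtractf[symmetric]
      by (intro sum.cong refl) (simp add: power2_eq_square algebra_simps)
    \<comment> \<open>The coefficient 12 is 3 times the square of the factor 2 in the mixed
      part.\<close>
    then have sq_le: "((\<Sum>i<n. u i t \<omega> * u i t \<omega>) - (\<Sum>i<n. (\<gamma> i)\<^sup>2 + \<sigma>\<^sub>v i i))\<^sup>2
        \<le> 3 * ((\<Gamma> n)\<^sup>2 * ((g t \<omega>)\<^sup>2 - 1)\<^sup>2) + 12 * ((h \<omega>)\<^sup>2 * (g t \<omega>)\<^sup>2) + 3 * (w \<omega>)\<^sup>2" for \<omega>
      using power2_add3_le[of "\<Gamma> n * ((g t \<omega>)\<^sup>2 - 1)" "2 * (h \<omega> * g t \<omega>)" "w \<omega>"]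
      by (simp add: power_mult_distrib)
    have "expectation (\<lambda>\<omega>. ((\<Sum>i<n. u i t \<omega> * u i t \<omega>) - (\<Sum>i<n. (\<gamma> i)\<^sup>2 + \<sigma>\<^sub>v i i))\<^sup>2)
        \<le> expectation (\<lambda>\<omega>. 3 * ((\<Gamma> n)\<^sup>2 * ((g t \<omega>)\<^sup>2 - 1)\<^sup>2) + 12 * ((h \<omega>)\<^sup>2 * (g t \<omega>)\<^sup>2) + 3 * (w \<omega>)\<^sup>2)"
      using g_part(1) gh(1) w2 by (intro integral_mono' sq_le) auto
    also have "\<dots> = 3 * ((\<Gamma> n)\<^sup>2 * expectation (\<lambda>\<omega>. ((g t \<omega>)\<^sup>2 - 1)\<^sup>2)) + 12 * expectation (\<lambda>\<omega>. (h \<omega>)\<^sup>2)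
        + 3 * expectation (\<lambda>\<omega>. (w \<omega>)\<^sup>2)"
      using g_part(1) gh w2 by simp
    also have "\<dots> \<le> 3 * ((\<Gamma> n)\<^sup>2 * C2) + 12 * (C3\<^sup>2 * C1 * real n) + 3 * (\<bar>C4\<bar> * real n)"
      using g_part(2) h2_mean w2_mean by (intro add_mono mult_left_mono) auto
    also have "\<dots> = 3 * C2 * (\<Gamma> n)\<^sup>2 + (12 * (C3\<^sup>2 * C1) + 3 * \<bar>C4\<bar>) * real n"
      by (simp add: algebra_simps)
    also have "\<dots> \<le> A * ((\<Gamma> n)\<^sup>2 + real n)"
      by (rule A(2)) auto
    finally show ?thesis .
  qed
  show thesis
  proof (rule that[OF A(1)[of 0 0 0 0]])
    show "expectation (\<lambda>\<omega>. ((\<Sum>i<n. u i s \<omega> * u i t \<omega>) - (if s = t then \<Sum>i<n. (\<gamma> i)\<^sup>2 + \<sigma>\<^sub>v i i else 0))\<^sup>2)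
      \<le> A * ((\<Sum>i<n. (\<gamma> i)\<^sup>2)\<^sup>2 + real n)" for n s t
      using off_diag[of s t n] diag[of t n] by (cases "s = t") (auto simp: \<Gamma>_def)
  qed auto
qed

end

subsection \<open>The variance estimator\<close>

text \<open>Exact finite-sample statements: dividing the residual sum of squares by
  \<open>n * N\<close> turns its mean into the average variance and leaves one factor
  \<open>N\<close> in the denominator of the second-moment bound.\<close>

lemma (in prob_space) sigma2_hat_moments:
  fixes f :: "nat \<Rightarrow> 'a \<Rightarrow> real ^ 'k"
  assumes lf: "latent_factor f g \<gamma> \<alpha>" and ie: "idiosyncratic_errors f g \<beta> v \<sigma>\<^sub>v"
    and u: "\<And>i t \<omega>. u i t \<omega> = \<gamma> i * g t \<omega> + v i t \<omega>"
    and r: "\<And>i t \<omega>. \<omega> \<in> space M \<Longrightarrow> r i t \<omega> = a i + \<beta> i \<omega> \<bullet> f t \<omega> + u i t \<omega>"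
    and \<sigma>2: "\<And>i t. \<sigma>2 i = expectation (\<lambda>\<omega>. (u i t \<omega>)\<^sup>2)"
    and pd: "AE \<omega> in M. pos_def (sample_cov T (\<lambda>t. f t \<omega>))"
    and T: "CARD('k) + 1 < T"
    and bound: "\<And>s t. expectation (\<lambda>\<omega>. ((\<Sum>i<n. u i s \<omega> * u i t \<omega>) - (if s = t then \<Sum>i<n. \<sigma>2 i else 0))\<^sup>2) \<le> B"
  defines "N \<equiv> real T - real CARD('k) - 1"
  shows "integrable M (sigma2_hat r f n T)"
    and "expectation (sigma2_hat r f n T) = sample_mean n \<sigma>2"
    and "0 < n \<Longrightarrow> integrable M (\<lambda>\<omega>. (sigma2_hat r f n T \<omega> - sample_mean n \<sigma>2)\<^sup>2)"
    and "0 < n \<Longrightarrow> expectation (\<lambda>\<omega>. (sigma2_hat r f n T \<omega> - sample_mean n \<sigma>2)\<^sup>2) \<le> 2 * B / ((real n)\<^sup>2 * N)"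
proof -
  note error = error_process[OF lf ie u]
  define x where "x t \<omega> = (1 :: real, f t \<omega>)" for t \<omega>
  define R where "R \<omega> = (\<Sum>i<n. \<Sum>t<T. (resid T (\<lambda>t. x t \<omega>) (\<lambda>t. u i t \<omega>) t)\<^sup>2)" for \<omega>
  have "0 < N" using T by (simp add: N_def)
  have x_indep: "indep_of (\<Pi>\<^sub>M t\<in>UNIV. \<Pi>\<^sub>M i\<in>UNIV. borel) (\<lambda>\<omega> t i. u i t \<omega>)
      (\<Pi>\<^sub>M t\<in>UNIV. borel) (\<lambda>\<omega> t. x t \<omega>)"
  proof -
    have "(\<lambda>y t. (1 :: real, y t)) \<in> (\<Pi>\<^sub>M t\<in>(UNIV :: nat set). (borel :: (real ^ 'k) measure))
        \<rightarrow>\<^sub>M (\<Pi>\<^sub>M t\<in>UNIV. borel)"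
      by (intro measurable_abs_UNIV borel_measurable_Pair borel_measurable_const measurable_component_singleton UNIV_I)
    from indep_of_compose[OF error(2) measurable_ident this] show ?thesis by (simp add: x_def)
  qed
  have trace: "AE \<omega> in M. (\<Sum>t<T. annihilator T (\<lambda>t. x t \<omega>) t t) = N"
    using pd
  proof eventually_elim
    case (elim \<omega>)
    \<comment> \<open>The augmented regressor has dimension one more than the number of factors,
      which accounts for the intercept.\<close>
    have "(\<Sum>t<T. annihilator T (\<lambda>t. x t \<omega>) t t) = real T - real DIM(real \<times> (real ^ 'k))"
      unfolding x_def using augmented_design_injective[OF elim] T by (intro trace_annihilator) auto
    then show ?case by (simp add: N_def)
  qed
  have "R = (\<lambda>\<omega>. \<Sum>i<n. \<Sum>t<T. (resid T (\<lambda>t. x t \<omega>) (\<lambda>t. u i t \<omega>) t)\<^sup>2)"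
    by (simp add: fun_eq_iff R_def)
  note R_moments = sum_resid_square_moments[OF error(1) x_indep error(4) error(5) \<sigma>2[symmetric] trace bound this]
  have hat: "sigma2_hat r f n T \<omega> = R \<omega> / (real n * N)" if "\<omega> \<in> space M" for \<omega>
  proof -
    have "(\<Sum>t<T. (ols_residual T (\<lambda>t. r i t \<omega>) (\<lambda>t. f t \<omega>) t)\<^sup>2)
        = (\<Sum>t<T. (resid T (\<lambda>t. x t \<omega>) (\<lambda>t. u i t \<omega>) t)\<^sup>2)" for i
    proof -
      \<comment> \<open>The argument is pathwise, so the coefficients
        \<open>(a i, \<beta> i \<omega>)\<close> may be random.\<close>
      have "(\<lambda>t. r i t \<omega>) = (\<lambda>t. (a i, \<beta> i \<omega>) \<bullet> x t \<omega> + u i t \<omega>)"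
        using r[OF that] by (simp add: x_def)
      then show ?thesis
        by (simp add: sum_ols_residual_square x_def[symmetric] resid_add_fitted)
    qed
    then show ?thesis
      unfolding sigma2_hat_def R_def N_def by (subst sum.swap) simp
  qed
  have dev: "sigma2_hat r f n T \<omega> - sample_mean n \<sigma>2 = (R \<omega> - N * (\<Sum>i<n. \<sigma>2 i)) / (real n * N)"
    if "\<omega> \<in> space M" for \<omega>
    using \<open>0 < N\<close> by (simp add: hat[OF that] sample_mean_def diff_divide_distrib)
  have "integrable M (\<lambda>\<omega>. R \<omega> / (real n * N))"
    using R_moments(1) by simp
  then show "integrable M (sigma2_hat r f n T)"
    by (simp add: hat cong: Bochner_Integration.integrable_cong)
  have "expectation (sigma2_hat r f n T) = expectation (\<lambda>\<omega>. R \<omega> / (real n * N))"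
    by (intro Bochner_Integration.integral_cong refl hat)
  \<comment> \<open>For \<open>n = 0\<close> both sides are 0 by the convention for division by
    zero.\<close>
  then show "expectation (sigma2_hat r f n T) = sample_mean n \<sigma>2"
    using R_moments(2) \<open>0 < N\<close> by (simp add: sample_mean_def)
  have sq: "(sigma2_hat r f n T \<omega> - sample_mean n \<sigma>2)\<^sup>2 = (R \<omega> - N * (\<Sum>i<n. \<sigma>2 i))\<^sup>2 / (real n * N)\<^sup>2"
    if "\<omega> \<in> space M" for \<omega>
    by (simp add: dev[OF that] power_divide)
  have "integrable M (\<lambda>\<omega>. (R \<omega> - N * (\<Sum>i<n. \<sigma>2 i))\<^sup>2 / (real n * N)\<^sup>2)"
    using R_moments(3) by simp
  then show "integrable M (\<lambda>\<omega>. (sigma2_hat r f n T \<omega> - sample_mean n \<sigma>2)\<^sup>2)"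
    by (simp add: sq cong: Bochner_Integration.integrable_cong)
  have "expectation (\<lambda>\<omega>. (sigma2_hat r f n T \<omega> - sample_mean n \<sigma>2)\<^sup>2)
      = expectation (\<lambda>\<omega>. (R \<omega> - N * (\<Sum>i<n. \<sigma>2 i))\<^sup>2 / (real n * N)\<^sup>2)"
    by (intro Bochner_Integration.integral_cong refl sq)
  also have "\<dots> = expectation (\<lambda>\<omega>. (R \<omega> - N * (\<Sum>i<n. \<sigma>2 i))\<^sup>2) / (real n * N)\<^sup>2"
    by simp
  also have "\<dots> \<le> 2 * B * N / (real n * N)\<^sup>2"
    using R_moments(4) by (intro divide_right_mono) auto
  also have "\<dots> = 2 * B / ((real n)\<^sup>2 * N)"
    using \<open>0 < N\<close> by (simp add: power2_eq_square)
  finally show "expectation (\<lambda>\<omega>. (sigma2_hat r f n T \<omega> - sample_mean n \<sigma>2)\<^sup>2) \<le> 2 * B / ((real n)\<^sup>2 * N)" .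
qed

section \<open>From second moments to the rate in probability\<close>

text \<open>Chebyshev's inequality. The premises are only eventual, since the rate of interest
  vanishes at \<open>n = 0\<close>.\<close>

lemma (in prob_space) bounded_in_probI:
  assumes b: "\<forall>\<^sub>F n in sequentially. 0 < b n"
    and X: "\<forall>\<^sub>F n in sequentially. random_variable borel (X n) \<and> integrable M (\<lambda>\<omega>. (X n \<omega>)\<^sup>2)
      \<and> expectation (\<lambda>\<omega>. (X n \<omega>)\<^sup>2) \<le> C * (b n)\<^sup>2"
  shows "bounded_in_prob X b"
  unfolding bounded_in_prob_def
proof (intro allI impI)
  fix \<epsilon> :: real assume "0 < \<epsilon>"
  \<comment> \<open>This makes \<open>\<epsilon> * B\<close> exceed \<open>C\<close>; as
    \<open>B \<ge> 1\<close>, also \<open>C / B^2 < \<epsilon>\<close>. It does not depend on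
    \<open>n\<close>.\<close>
  define B where "B = 1 + \<bar>C\<bar> / \<epsilon>"
  have "1 \<le> B" using \<open>0 < \<epsilon>\<close> by (simp add: B_def)
  have "C < \<epsilon> * B" using \<open>0 < \<epsilon>\<close> by (simp add: B_def distrib_left)
  also have "\<dots> \<le> \<epsilon> * B\<^sup>2"
    using \<open>0 < \<epsilon>\<close> \<open>1 \<le> B\<close> by (intro mult_left_mono) (auto simp: power2_eq_square)
  finally have "C / B\<^sup>2 < \<epsilon>"
    using \<open>1 \<le> B\<close> by (simp add: divide_less_eq)
  have "\<forall>\<^sub>F n in sequentially. prob {\<omega> \<in> space M. B * b n < \<bar>X n \<omega>\<bar>} < \<epsilon>"
    using b X
  proof eventually_elim
    case (elim n)
    have [measurable]: "random_variable borel (X n)" using elim by simp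
    have "prob {\<omega> \<in> space M. B * b n < \<bar>X n \<omega>\<bar>} \<le> prob {\<omega> \<in> space M. B * b n \<le> \<bar>X n \<omega>\<bar>}"
      by (intro finite_measure_mono) auto
    also have "\<dots> \<le> expectation (\<lambda>\<omega>. (X n \<omega>)\<^sup>2) / (B * b n)\<^sup>2"
      using elim \<open>1 \<le> B\<close> by (intro second_moment_method) auto
    also have "\<dots> \<le> C * (b n)\<^sup>2 / (B * b n)\<^sup>2"
      using elim by (intro divide_right_mono) auto
    also have "\<dots> = C / B\<^sup>2"
      using elim by (simp add: power_mult_distrib)
    finally show ?case using \<open>C / B\<^sup>2 < \<epsilon>\<close> by linarith
  qed
  then show "\<exists>B. \<forall>\<^sub>F n in sequentially. prob {\<omega> \<in> space M. B * b n < \<bar>X n \<omega>\<bar>} < \<epsilon>" ..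
qed

text \<open>Integrability is part of the conclusion, so that the expectations are not default
  values. The rate is claimed along every horizon \<open>S'\<close>, covering fixed and jointly
  diverging numbers of periods.\<close>

theorem theorem2:
  fixes M :: "'w measure"
    and f :: "nat \<Rightarrow> 'w \<Rightarrow> real ^ 'k"
    and \<beta> :: "nat \<Rightarrow> 'w \<Rightarrow> real ^ 'k"
    and g :: "nat \<Rightarrow> 'w \<Rightarrow> real"
    and u v r :: "nat \<Rightarrow> nat \<Rightarrow> 'w \<Rightarrow> real"
    and a \<gamma> \<sigma>2 :: "nat \<Rightarrow> real"
    and \<sigma>\<^sub>v :: "nat \<Rightarrow> nat \<Rightarrow> real"
    and \<mu>\<^sub>0 :: "real ^ 'k"
    and \<alpha>\<^sub>\<gamma> \<sigma>bar2 :: real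
    and T0 :: nat and S :: "nat \<Rightarrow> nat"
  assumes "prob_space M"
    and returns: "\<And>i t \<omega>. \<omega> \<in> space M \<Longrightarrow> r i t \<omega> = a i + \<beta> i \<omega> \<bullet> f t \<omega> + u i t \<omega>"
    and errors: "\<And>i t \<omega>. \<omega> \<in> space M \<Longrightarrow> u i t \<omega> = \<gamma> i * g t \<omega> + v i t \<omega>"
    and "prob_space.observed_factors M f \<mu>\<^sub>0 T0"
    and "prob_space.latent_factor M f g \<gamma> \<alpha>\<^sub>\<gamma>" and "\<alpha>\<^sub>\<gamma> < 1/2"
    and "prob_space.idiosyncratic_errors M f g \<beta> v \<sigma>\<^sub>v"
    and "horizon (max T0 (CARD('k) + 1)) S" and "prob_space.loading_error_clt M \<beta> v \<sigma>\<^sub>v S"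
    and variances: "\<And>i t. \<sigma>2 i = (\<integral>\<omega>. (u i t \<omega>)\<^sup>2 \<partial>M)"
    and limit: "(\<lambda>n. sample_mean n \<sigma>2) \<longlonglongrightarrow> \<sigma>bar2"
  shows "(\<forall>T. T0 < T \<and> CARD('k) + 1 < T \<longrightarrow>
            (\<forall>n. integrable M (sigma2_hat r f n T)) \<and>
            (\<lambda>n. \<integral>\<omega>. sigma2_hat r f n T \<omega> \<partial>M) \<longlonglongrightarrow> \<sigma>bar2) \<and>
         (\<forall>S'. horizon (max T0 (CARD('k) + 1)) S' \<longrightarrow>
            prob_space.bounded_in_prob M
              (\<lambda>n \<omega>. sigma2_hat r f n (S' n) \<omega> - sample_mean n \<sigma>2)
              (\<lambda>n. real (S' n) powr (- 1/2) * real n powr (- 1/2)))"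
proof -
  interpret prob_space M by fact
  note obs = assms(4) and lf = assms(5) and ie = assms(7)
  \<comment> \<open>The model equation for \<open>u\<close> is given on \<open>space M\<close> only;
    \<open>u'\<close> satisfies it at every point and agrees with \<open>u\<close> there.\<close>
  define u' where "u' i t \<omega> = \<gamma> i * g t \<omega> + v i t \<omega>" for i t \<omega>
  have u_eq: "u i t \<omega> = u' i t \<omega>" if "\<omega> \<in> space M" for i t \<omega>
    using errors[OF that] by (simp add: u'_def)
  have r: "r i t \<omega> = a i + \<beta> i \<omega> \<bullet> f t \<omega> + u' i t \<omega>" if "\<omega> \<in> space M" for i t \<omega>
    using returns[OF that] u_eq[OF that] by simp
  have \<sigma>2: "\<sigma>2 i = expectation (\<lambda>\<omega>. (u' i t \<omega>)\<^sup>2)" for i t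
    unfolding variances[of i t] by (intro Bochner_Integration.integral_cong) (simp_all add: u_eq)
  \<comment> \<open>This identifies the centring in the cross-product bound with the error
    variances.\<close>
  have \<sigma>2_eq: "\<sigma>2 i = (\<gamma> i)\<^sup>2 + \<sigma>\<^sub>v i i" for i
    using \<sigma>2[of i 0] error_covariance[OF lf ie u'_def, of i 0 i] by (simp add: power2_eq_square)
  obtain A where A: "0 \<le> A" and bound:
    "\<And>n s t. expectation (\<lambda>\<omega>. ((\<Sum>i<n. u' i s \<omega> * u' i t \<omega>) - (if s = t then \<Sum>i<n. \<sigma>2 i else 0))\<^sup>2)
      \<le> A * ((\<Sum>i<n. (\<gamma> i)\<^sup>2)\<^sup>2 + real n)"
    by (rule error_cross_product_second_moment[OF lf ie u'_def, folded \<sigma>2_eq]) (rule that)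
  have pd: "AE \<omega> in M. pos_def (sample_cov T (\<lambda>t. f t \<omega>))" if "T0 < T" for T
  proof -
    have "AE \<omega> in M. \<forall>T>T0. full_column_rank T (\<lambda>t. f t \<omega>) \<and> pos_def (sample_cov T (\<lambda>t. f t \<omega>))"
      using obs by (simp add: observed_factors_def)
    then show ?thesis by eventually_elim (use that in simp)
  qed
  note moments = sigma2_hat_moments[OF lf ie u'_def r \<sigma>2 pd _ bound]
  obtain C where "\<And>i. \<bar>\<gamma> i\<bar> < C" and O: "(\<lambda>n. \<Sum>i<n. \<bar>\<gamma> i\<bar>) \<in> O(\<lambda>n. real n powr \<alpha>\<^sub>\<gamma>)"
    using lf by (auto simp: latent_factor_def)
  then have le: "\<bar>\<gamma> i\<bar> \<le> C" for i
    by (simp add: less_imp_le)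
  obtain D where "0 \<le> D" and D: "\<forall>\<^sub>F n in sequentially. (\<Sum>i<n. (\<gamma> i)\<^sup>2)\<^sup>2 \<le> D * real n"
    by (rule weak_loadings_sum_square[OF le O assms(6)]) (rule that)
  have "bounded_in_prob (\<lambda>n \<omega>. sigma2_hat r f n (S' n) \<omega> - sample_mean n \<sigma>2)
      (\<lambda>n. real (S' n) powr (- 1/2) * real n powr (- 1/2))"
    if S': "horizon (max T0 (CARD('k) + 1)) S'" for S'
  proof (rule bounded_in_probI)
    have T: "T0 < S' n" "CARD('k) + 1 < S' n" for n
      using S' by (auto simp: horizon_def)
    show "\<forall>\<^sub>F n in sequentially. 0 < real (S' n) powr (- 1/2) * real n powr (- 1/2)"
      using eventually_gt_at_top[of 0]
    proof eventually_elim
      case (elim n)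
      have "0 < S' n" using T(2)[of n] by linarith
      then show ?case using elim by (intro mult_pos_pos) auto
    qed
    \<comment> \<open>The factor 2 comes from the transposed pairs, \<open>D + 1\<close> from
      bounding the squared loadings term plus \<open>n\<close>, and the last factor from replacing
      \<open>N\<close> by \<open>S' n\<close>.\<close>
    define C where "C = 2 * A * (D + 1) * (real CARD('k) + 2)"
    show "\<forall>\<^sub>F n in sequentially.
        random_variable borel (\<lambda>\<omega>. sigma2_hat r f n (S' n) \<omega> - sample_mean n \<sigma>2)
        \<and> integrable M (\<lambda>\<omega>. (sigma2_hat r f n (S' n) \<omega> - sample_mean n \<sigma>2)\<^sup>2)
        \<and> expectation (\<lambda>\<omega>. (sigma2_hat r f n (S' n) \<omega> - sample_mean n \<sigma>2)\<^sup>2)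
          \<le> C * (real (S' n) powr (- 1/2) * real n powr (- 1/2))\<^sup>2"
      using D eventually_gt_at_top[of 0]
    proof eventually_elim
      case (elim n)
      define N where "N = real (S' n) - real CARD('k) - 1"
      have "0 < N" using T(2)[of n] by (simp add: N_def)
      \<comment> \<open>With \<open>K = CARD('k)\<close>, the difference of the two sides is
        \<open>(K + 1) * (S' n - (K + 2))\<close>, nonnegative because \<open>S' n\<close> is an
        integer above \<open>K + 1\<close>.\<close>
      have "real (S' n) \<le> (real CARD('k) + 2) * N"
      proof -
        have "real CARD('k) + 2 \<le> real (S' n)" using T(2)[of n] by linarith
        then have "0 \<le> (real CARD('k) + 1) * (real (S' n) - (real CARD('k) + 2))" by simp
        then show ?thesis by (simp add: N_def algebra_simps)
      qed
      then have N_ge: "1 / N \<le> (real CARD('k) + 2) / real (S' n)"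
        using \<open>0 < N\<close> T(2)[of n] by (simp add: field_simps)
      have rate: "(real (S' n) powr (- 1/2) * real n powr (- 1/2))\<^sup>2 = 1 / (real (S' n) * real n)"
        using T(2)[of n] elim
        by (simp add: power2_eq_square powr_minus powr_half_sqrt field_simps)
      have "expectation (\<lambda>\<omega>. (sigma2_hat r f n (S' n) \<omega> - sample_mean n \<sigma>2)\<^sup>2)
          \<le> 2 * (A * ((\<Sum>i<n. (\<gamma> i)\<^sup>2)\<^sup>2 + real n)) / ((real n)\<^sup>2 * N)"
        using moments(4)[OF _ T elim(2)] by (simp add: N_def)
      also have "\<dots> \<le> 2 * (A * (D * real n + real n)) / ((real n)\<^sup>2 * N)"
        using elim A \<open>0 < N\<close> by (intro divide_right_mono mult_left_mono add_right_mono) auto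
      also have "\<dots> = 2 * A * (D + 1) / real n * (1 / N)"
        using elim \<open>0 < N\<close> by (simp add: power2_eq_square field_simps)
      also have "\<dots> \<le> 2 * A * (D + 1) / real n * ((real CARD('k) + 2) / real (S' n))"
        using A \<open>0 \<le> D\<close> by (intro mult_left_mono N_ge) auto
      also have "\<dots> = C * (real (S' n) powr (- 1/2) * real n powr (- 1/2))\<^sup>2"
        unfolding rate C_def by simp
      finally show ?case
        using moments(1)[OF _ T(1,2), of n n] moments(3)[OF _ T elim(2)] by auto
    qed
  qed
  \<comment> \<open>By exact unbiasedness the sequence of expectations is the sequence of average
    variances, whose limit is given.\<close>
  then show ?thesis
    using moments(1,2) limit by auto
qed

end
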